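(* Let $n$ be an integer and let $a,b,c$ be complex numbers such that $\mathrm{Re}(a-2b-2c-n)>0$, none of $a-b$, $a-c$, $a$, $\frac{a+1}{2}-b-c$, $\frac a2-b-c$ is zero or a negative integer, and no denominator vanishes in the expressions for $\tilde P(n)$ and $\tilde Q(n)$ below. Then $$ {}_3F_2\!\left({a+n,\,b,\,c\atop a-b,\,a-c}\right)=\frac{\tilde P(n)}{2}\,\frac{\Gamma(\frac{a+1}{2})\,\Gamma(a-b)\,\Gamma(a-c)\,\Gamma(\frac{a+1}{2}-b-c)}{\Gamma(a)\,\Gamma(\frac{a+1}{2}-b)\,\Gamma(\frac{a+1}{2}-c)\,\Gamma(a-b-c)}+\frac{\tilde Q(n)}{2}\,\frac{\Gamma(\frac{a}{2})\,\Gamma(a-b)\,\Gamma(a-c)\,\Gamma(\frac{a}{2}-b-c)}{\Gamma(a)\,\Gamma(\frac{a}{2}-b)\,\Gamma(\frac{a}{2}-c)\,\Gamma(a-b-c)}, $$ where $\tilde P(-1)=2$, $\tilde Q(-1)=0$; for $n\ge 0$ $$ \tilde P(n)={}_4F_3\!\left({-\frac n2,\,-\frac{n+1}{2},\,b,\,c\atop -n,\,\frac a2,\,\frac{1-a}{2}+b+c}\right),\qquad \tilde Q(n)={}_4F_3\!\left({-\frac{n-1}{2},\,-\frac n2,\,b,\,c\atop -n,\,\frac{1+a}{2},\,1-\frac a2+b+c}\right); $$ and for negative indices $-m-1$ with $m\ge 1$ $$ \tilde P(-m-1)=2^{2m}\,\frac{(1-\frac a2)_m\,(\frac{1+a}{2}-b-c)_m}{(1-b)_m\,(1-c)_m}\;{}_4F_3\!\left({-\frac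 m2,\,-\frac{m-1}{2},\,b-m,\,c-m\atop 1-m,\,\frac a2-m,\,\frac{1-a}{2}+b+c-m}\right), $$ $$ \tilde Q(-m-1)=-2^{2m}\,\frac{(\frac{1-a}{2})_m\,(\frac{a}{2}-b-c)_m}{(1-b)_m\,(1-c)_m}\;{}_4F_3\!\left({-\frac{m-1}{2},\,-\frac{m-2}{2},\,b-m,\,c-m\atop 1-m,\,\frac{1+a}{2}-m,\,1-\frac{a}{2}+b+c-m}\right). $$
   Context: Notation: $(x)_k=x(x+1)\cdots(x+k-1)$ for $k\ge 0$, with $(x)_0=1$. ${}_3F_2\!\left({A,B,C\atop E,F}\right)=\sum_{k\ge 0}\frac{(A)_k(B)_k(C)_k}{(E)_k(F)_k\,k!}$ and ${}_4F_3\!\left({A,B,C,D\atop E,F,G}\right)=\sum_{k\ge 0}\frac{(A)_k(B)_k(C)_k(D)_k}{(E)_k(F)_k(G)_k\,k!}$ denote hypergeometric series at argument $1$. The ${}_3F_2$ series on the left converges absolutely when $\mathrm{Re}(a-2b-2c-n)>0$. All ${}_4F_3$ series here are interpreted as terminating sums, cut off by the upper parameter which is a non-positive integer (the one among the first two): for $n\ge0$ the sum in $\tilde P(n)$ is over $0\le k\le\lceil n/2\rceil$ and in $\tilde Q(n)$ over $0\le k\le\lfloor n/2\rfloor$; for $m\ge 1$ the sum in $\tilde P(-m-1)$ is over $0\le k\le\lfloor m/2\rfloor$ and in $\tilde Q(-m-1)$ over $0\le k\le\lfloor (m-1)/2\rfloor$. $1/\Gamma$ is taken to be $0$ at the poles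 of $\Gamma$. *)

theory Defs
  imports "HOL-Analysis.Analysis"
begin

definition hyp3F2 :: "complex \<Rightarrow> complex \<Rightarrow> complex \<Rightarrow> complex \<Rightarrow> complex \<Rightarrow> complex" where
  "hyp3F2 A B C E F =
     (\<Sum>k. (pochhammer A k * pochhammer B k * pochhammer C k) /
          (pochhammer E k * pochhammer F k * fact k))"

(* The series 4F3 at argument 1 cut off after the term of index N.  The cut-off is explicit
   because the lower parameters used below include non-positive integers such as -n. *)
definition hyp4F3_upto ::
  "nat \<Rightarrow> complex \<Rightarrow> complex \<Rightarrow> complex \<Rightarrow> complex \<Rightarrow> complex \<Rightarrow> complex \<Rightarrow> complex \<Rightarrow> complex" where
  "hyp4F3_upto N A B C D E F G =
     (\<Sum>k\<le>N. (pochhammer A k * pochhammer B k * pochhammer C k * pochhammer D k) /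
            (pochhammer E k * pochhammer F k * pochhammer G k * fact k))"

definition hyp4F3_upto_ok :: "nat \<Rightarrow> complex \<Rightarrow> complex \<Rightarrow> complex \<Rightarrow> bool" where
  "hyp4F3_upto_ok N E F G \<longleftrightarrow>
     (\<forall>k\<le>N. pochhammer E k * pochhammer F k * pochhammer G k * fact k \<noteq> 0)"

(* (n + 1) div 2 is the ceiling of n / 2. *)
definition Ptilde_nonneg :: "complex \<Rightarrow> complex \<Rightarrow> complex \<Rightarrow> nat \<Rightarrow> complex" where
  "Ptilde_nonneg a b c n =
     hyp4F3_upto ((n + 1) div 2)
       (- of_nat n / 2) (- (of_nat n + 1) / 2) b c
       (- of_nat n) (a / 2) ((1 - a) / 2 + b + c)"

definition Qtilde_nonneg :: "complex \<Rightarrow> complex \<Rightarrow> complex \<Rightarrow> nat \<Rightarrow> complex" where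
  "Qtilde_nonneg a b c n =
     hyp4F3_upto (n div 2)
       (- (of_nat n - 1) / 2) (- of_nat n / 2) b c
       (- of_nat n) ((1 + a) / 2) (1 - a / 2 + b + c)"

(* The values at the index -m-1, meant for m \<ge> 1. *)
definition Ptilde_neg :: "complex \<Rightarrow> complex \<Rightarrow> complex \<Rightarrow> nat \<Rightarrow> complex" where
  "Ptilde_neg a b c m =
     2 ^ (2 * m) *
     ((pochhammer (1 - a / 2) m * pochhammer ((1 + a) / 2 - b - c) m) /
      (pochhammer (1 - b) m * pochhammer (1 - c) m)) *
     hyp4F3_upto (m div 2)
       (- of_nat m / 2) (- (of_nat m - 1) / 2) (b - of_nat m) (c - of_nat m)
       (1 - of_nat m) (a / 2 - of_nat m) ((1 - a) / 2 + b + c - of_nat m)"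

definition Qtilde_neg :: "complex \<Rightarrow> complex \<Rightarrow> complex \<Rightarrow> nat \<Rightarrow> complex" where
  "Qtilde_neg a b c m =
     - (2 ^ (2 * m)) *
     ((pochhammer ((1 - a) / 2) m * pochhammer (a / 2 - b - c) m) /
      (pochhammer (1 - b) m * pochhammer (1 - c) m)) *
     hyp4F3_upto ((m - 1) div 2)
       (- (of_nat m - 1) / 2) (- (of_nat m - 2) / 2) (b - of_nat m) (c - of_nat m)
       (1 - of_nat m) ((1 + a) / 2 - of_nat m) (1 - a / 2 + b + c - of_nat m)"

definition Ptilde :: "complex \<Rightarrow> complex \<Rightarrow> complex \<Rightarrow> int \<Rightarrow> complex" where
  "Ptilde a b c n =
     (if n = -1 then 2
      else if 0 \<le> n then Ptilde_nonneg a b c (nat n)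
      else Ptilde_neg a b c (nat (- n - 1)))"

definition Qtilde :: "complex \<Rightarrow> complex \<Rightarrow> complex \<Rightarrow> int \<Rightarrow> complex" where
  "Qtilde a b c n =
     (if n = -1 then 0
      else if 0 \<le> n then Qtilde_nonneg a b c (nat n)
      else Qtilde_neg a b c (nat (- n - 1)))"

(* No denominator occurring in the expression for Ptilde (resp. Qtilde) at index n vanishes;
   only the terms that are actually summed are constrained. *)
definition Ptilde_ok :: "complex \<Rightarrow> complex \<Rightarrow> complex \<Rightarrow> int \<Rightarrow> bool" where
  "Ptilde_ok a b c n \<longleftrightarrow>
     (if n = -1 then True
      else if 0 \<le> n then
        hyp4F3_upto_ok ((nat n + 1) div 2) (- of_int n) (a / 2) ((1 - a) / 2 + b + c)
      else (let m = nat (- n - 1) in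
        pochhammer (1 - b) m * pochhammer (1 - c) m \<noteq> 0 \<and>
        hyp4F3_upto_ok (m div 2)
          (1 - of_nat m) (a / 2 - of_nat m) ((1 - a) / 2 + b + c - of_nat m)))"

definition Qtilde_ok :: "complex \<Rightarrow> complex \<Rightarrow> complex \<Rightarrow> int \<Rightarrow> bool" where
  "Qtilde_ok a b c n \<longleftrightarrow>
     (if n = -1 then True
      else if 0 \<le> n then
        hyp4F3_upto_ok (nat n div 2) (- of_int n) ((1 + a) / 2) (1 - a / 2 + b + c)
      else (let m = nat (- n - 1) in
        pochhammer (1 - b) m * pochhammer (1 - c) m \<noteq> 0 \<and>
        hyp4F3_upto_ok ((m - 1) div 2)
          (1 - of_nat m) ((1 + a) / 2 - of_nat m) (1 - a / 2 + b + c - of_nat m)))"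

end

theory Submission
  imports Defs
begin

text \<open>
  Divide the series by \<open>Gamma (a - b) * Gamma (a - c)\<close>, so that all its terms are entire, and call the
  result \<open>F n a b c\<close>. The identity \<open>(A)\<^sub>k - (A - 1)\<^sub>k = k * (A)\<^sub>k\<^sub>-\<^sub>1\<close> gives
  \<open>F n a b c = F (n - 1) a b c + b * c * F (n - 2) (a + 2) (b + 1) (c + 1)\<close>,
  a Lucas recurrence whose shifts do not worsen the convergence. It reduces both directions of \<open>n\<close> to
  \<open>n = -1\<close> and \<open>n = 0\<close>, and the coefficients of the Lucas and Fibonacci polynomials are those of the two
  4F3 sums. The case \<open>n = -1\<close> is Dixon's theorem, and \<open>2 * F 0 - F (-1)\<close> is a companion of it
  (a well-poised 5F4 series). Gosper telescoping links the first at \<open>a\<close> with the second at \<open>a + 1\<close> and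
  the second at \<open>a\<close> with the first at \<open>a + 1\<close>; the closed forms follow by letting \<open>a\<close> tend to infinity
  along \<open>a + 2 * n\<close>, where only the first term of the series survives.
\<close>

text \<open>With \<open>D\<close> for Dixon's product and \<open>C\<close> for its companion, the
  initial data are \<open>2 * F (-1) = 2 * D + 0 * C\<close> and \<open>2 * F 0 = D + C\<close>. The
  coefficients (2, 1) and (0, 1) start the Lucas and Fibonacci polynomials and explain the values 2
  and 0 at index -1. The two-step branch moves \<open>a\<close> by 2 and \<open>b\<close>,
  \<open>c\<close> by 1. This fixes \<open>v - b\<close>, \<open>v - c\<close> and
  \<open>a - b - c\<close>, so a Dixon product only picks up
  \<open>-4 * u * (1 - v + b + c)\<close>. Hence the last two lower parameters of each 4F3 come from
  Gamma factors, the last two upper ones from the factors \<open>b * c\<close>, and the other three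
  from the polynomial coefficients. The companion is well-poised because
  \<open>2 * (a)_k - (a - 1)_k = (a + 2 * k - 1) * (a)_(k-1)\<close> for k \<ge> 1. An obstacle is
  that the factors on the way from \<open>a\<close> to \<open>a + 2 * n\<close> may vanish. Series
  and product are therefore compared by cross multiplication, never by dividing by the accumulated
  factor.\<close>

section \<open>Asymptotics of the reciprocal Gamma function under integer shifts\<close>

text \<open>The product form of Gamma gives the limit off the poles, and the functional equation
  carries it down past them. As \<open>z\<close> is arbitrary, the growth estimates below hold for
  all parameters.\<close>

lemma rGamma_shift_asymptotics:
  fixes z :: complex
  shows "(\<lambda>n. fact (n - 1) * exp (z * of_real (ln (of_nat n))) * rGamma (z + of_nat n)) \<longlonglongrightarrow> 1"
proof -
  have regular: "(\<lambda>n. fact (n - 1) * exp (z * of_real (ln (of_nat n))) * rGamma (z + of_nat n)) \<longlonglongrightarrow> 1"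
    if z: "z \<notin> \<int>\<^sub>\<le>\<^sub>0" for z :: complex
  proof -
    have "(\<lambda>n. rGamma z * Gamma_series' z n) \<longlonglongrightarrow> rGamma z * Gamma z"
      by (intro tendsto_intros Gamma_series'_LIMSEQ)
    also have "rGamma z * Gamma z = 1"
      using z by (simp add: Gamma_def rGamma_eq_zero_iff)
    also have "(\<lambda>n. rGamma z * Gamma_series' z n) =
        (\<lambda>n. fact (n - 1) * exp (z * of_real (ln (of_nat n))) * rGamma (z + of_nat n))"
    proof
      fix n
      have "pochhammer z n \<noteq> 0"
        using z pochhammer_eq_0_imp_nonpos_Int by blast
      thus "rGamma z * Gamma_series' z n =
          fact (n - 1) * exp (z * of_real (ln (of_nat n))) * rGamma (z + of_nat n)"
        by (subst pochhammer_rGamma[of z n]) (simp add: Gamma_series'_def)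
    qed
    finally show ?thesis .
  qed
  \<comment> \<open>Lowering the argument by one gives a factor \<open>v + n\<close> from
    \<open>rGamma\<close> and costs one factor \<open>n\<close> from the power; their quotient
    \<open>1 + v / n\<close> tends to 1.\<close>
  have down: "(\<lambda>n. fact (n - 1) * exp ((w - of_nat j) * of_real (ln (of_nat n))) *
      rGamma ((w - of_nat j) + of_nat n)) \<longlonglongrightarrow> 1" if w: "w \<notin> \<int>\<^sub>\<le>\<^sub>0" for w :: complex and j :: nat
  proof (induction j)
    case 0
    show ?case using regular[OF w] by simp
  next
    case (Suc j)
    define v where "v = w - of_nat (Suc j)"
    have v1: "w - of_nat j = v + 1" by (simp add: v_def)
    have lim: "(\<lambda>n. 1 + v / of_nat n) \<longlonglongrightarrow> 1 + 0"
      by (intro tendsto_intros lim_1_over_n[THEN tendsto_mult_left[of _ _ _ v], simplified])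
    have "(\<lambda>n. (1 + v / of_nat n) * (fact (n - 1) * exp ((v + 1) * of_real (ln (of_nat n))) *
        rGamma (v + 1 + of_nat n))) \<longlonglongrightarrow> (1 + 0) * 1"
      by (intro tendsto_mult lim) (use Suc v1 in simp)
    moreover have "\<forall>\<^sub>F n in sequentially. (1 + v / of_nat n) * (fact (n - 1) *
        exp ((v + 1) * of_real (ln (of_nat n))) * rGamma (v + 1 + of_nat n)) =
        fact (n - 1) * exp (v * of_real (ln (of_nat n))) * rGamma (v + of_nat n)"
      using eventually_gt_at_top[of 0]
    proof eventually_elim
      case (elim n)
      have "rGamma (v + of_nat n) = (v + of_nat n) * rGamma (v + 1 + of_nat n)"
        using rGamma_plus1[of "v + of_nat n"] by (simp add: add_ac)
      moreover have "exp ((v + 1) * of_real (ln (of_nat n))) =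
          exp (v * of_real (ln (of_nat n))) * of_nat n"
        using elim by (simp add: ring_distribs exp_add exp_of_real)
      ultimately show ?case using elim by (simp add: field_simps)
    qed
    ultimately have "(\<lambda>n. fact (n - 1) * exp (v * of_real (ln (of_nat n))) *
        rGamma (v + of_nat n)) \<longlonglongrightarrow> (1 + 0) * 1"
      by (rule Lim_transform_eventually)
    thus ?case by (simp add: v_def)
  qed
  obtain j :: nat where j: "- Re z < of_nat j" using reals_Archimedean2 by blast
  have "z + of_nat j \<notin> \<int>\<^sub>\<le>\<^sub>0"
    using j by (auto elim!: nonpos_Ints_cases' dest: arg_cong[of _ _ Re])
  from down[OF this, of j] show ?thesis by simp
qed

lemma rGamma_shift_nonzero:
  fixes z :: complex
  shows "\<forall>\<^sub>F n in sequentially. rGamma (z + of_nat n) \<noteq> 0"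
proof -
  have "\<forall>\<^sub>F n in sequentially. fact (n - 1) * exp (z * of_real (ln (of_nat n))) * rGamma (z + of_nat n) \<noteq> 0"
    by (rule tendsto_imp_eventually_ne[OF rGamma_shift_asymptotics]) simp
  thus ?thesis by eventually_elim auto
qed

text \<open>The assumption makes the powers of \<open>n\<close> cancel; the factorials cancel since
  there are two factors above and two below.\<close>

lemma rGamma_quotient_limit:
  fixes p q r s :: complex
  assumes "p + q = r + s"
  shows "(\<lambda>n. rGamma (p + of_nat n) * rGamma (q + of_nat n) /
      (rGamma (r + of_nat n) * rGamma (s + of_nat n))) \<longlonglongrightarrow> 1"
proof -
  define h where "h z n = fact (n - 1) * exp (z * of_real (ln (of_nat n))) * rGamma (z + of_nat n)"
    for z :: complex and n :: nat
  have h: "h z \<longlonglongrightarrow> 1" for z unfolding h_def by (rule rGamma_shift_asymptotics)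
  have "(\<lambda>n. h p n * h q n / (h r n * h s n)) \<longlonglongrightarrow> 1 * 1 / (1 * 1)"
    by (intro tendsto_intros h) auto
  also have "(\<lambda>n. h p n * h q n / (h r n * h s n)) = (\<lambda>n. rGamma (p + of_nat n) * rGamma (q + of_nat n) /
      (rGamma (r + of_nat n) * rGamma (s + of_nat n)))"
  proof
    fix n
    define l where "l = complex_of_real (ln (of_nat n))"
    have e: "exp (p * l) * exp (q * l) = exp (r * l) * exp (s * l)"
      using assms by (simp flip: exp_add distrib_right)
    have "h p n * h q n / (h r n * h s n) =
      (fact (n-1))\<^sup>2 * (exp (p * l) * exp (q * l)) * (rGamma (p + of_nat n) * rGamma (q + of_nat n)) /
      ((fact (n-1))\<^sup>2 * (exp (r * l) * exp (s * l)) * (rGamma (r + of_nat n) * rGamma (s + of_nat n)))"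
      by (simp add: h_def l_def power2_eq_square mult_ac)
    thus "h p n * h q n / (h r n * h s n) = rGamma (p + of_nat n) * rGamma (q + of_nat n) /
      (rGamma (r + of_nat n) * rGamma (s + of_nat n))"
      unfolding e by simp
  qed
  finally show ?thesis by simp
qed

section \<open>The regularised 3F2 series\<close>

text \<open>Dividing by \<open>Gamma E * Gamma F\<close> makes the terms entire in all parameters, so parameter shifts
  cannot run into poles.\<close>

definition hyp_term :: "complex \<Rightarrow> complex \<Rightarrow> complex \<Rightarrow> complex \<Rightarrow> complex \<Rightarrow> nat \<Rightarrow> complex" where
  "hyp_term A B C E F k = pochhammer A k * pochhammer B k * pochhammer C k / fact k *
     (rGamma (E + of_nat k) * rGamma (F + of_nat k))"

definition hyp_reg :: "complex \<Rightarrow> complex \<Rightarrow> complex \<Rightarrow> complex \<Rightarrow> complex \<Rightarrow> complex" where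
  "hyp_reg A B C E F = (\<Sum>k. hyp_term A B C E F k)"

text \<open>Writing \<open>(z)_k\<close> as \<open>rGamma z / rGamma (z + k)\<close> shows that the
  terms behave like a constant times \<open>k\<close> to the power \<open>-1 - s\<close>, where
  \<open>s = E + F - A - B - C\<close> is the parametric excess. The real part of \<open>s\<close>
  governs convergence throughout.\<close>

lemma hyp_term_asymptotics:
  "(\<lambda>k. hyp_term A B C E F k * (of_nat k * exp ((E + F - A - B - C) * of_real (ln (of_nat k)))))
     \<longlonglongrightarrow> rGamma A * rGamma B * rGamma C"
proof -
  define h where "h z n = fact (n - 1) * exp (z * of_real (ln (of_nat n))) * rGamma (z + of_nat n)"
    for z :: complex and n :: nat
  have h: "h z \<longlonglongrightarrow> 1" for z unfolding h_def by (rule rGamma_shift_asymptotics)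
  have "(\<lambda>k. rGamma A * rGamma B * rGamma C * (h E k * h F k) / (h A k * h B k * h C k))
      \<longlonglongrightarrow> rGamma A * rGamma B * rGamma C * (1 * 1) / (1 * 1 * 1)"
    by (intro tendsto_intros h) auto
  moreover have "\<forall>\<^sub>F k in sequentially.
     rGamma A * rGamma B * rGamma C * (h E k * h F k) / (h A k * h B k * h C k) =
     hyp_term A B C E F k * (of_nat k * exp ((E + F - A - B - C) * of_real (ln (of_nat k))))"
    using eventually_gt_at_top[of 0] rGamma_shift_nonzero[of A] rGamma_shift_nonzero[of B]
      rGamma_shift_nonzero[of C]
  proof eventually_elim
    case (elim k)
    define l where "l = complex_of_real (ln (of_nat k))"
    have poch: "rGamma z = pochhammer z k * rGamma (z + of_nat k)" for z :: complex
      by (rule pochhammer_rGamma)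
    have fk: "(fact k :: complex) = of_nat k * fact (k - 1)"
      using elim(1) by (simp add: fact_reduce)
    have e: "exp ((E + F - A - B - C) * l) =
        exp (E * l) * exp (F * l) / (exp (A * l) * exp (B * l) * exp (C * l))"
      by (simp add: exp_diff exp_add left_diff_distrib distrib_right)
    show ?case
      unfolding hyp_term_def h_def l_def[symmetric] fk e
      using elim by (subst poch[of A], subst poch[of B], subst poch[of C]) (simp add: field_simps)
  qed
  ultimately have "(\<lambda>k. hyp_term A B C E F k * (of_nat k * exp ((E + F - A - B - C) * of_real (ln (of_nat k)))))
      \<longlonglongrightarrow> rGamma A * rGamma B * rGamma C * (1 * 1) / (1 * 1 * 1)"
    by (rule Lim_transform_eventually)
  thus ?thesis by simp
qed

lemma hyp_term_bound:
  "\<exists>M. \<forall>\<^sub>F k in sequentially.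
     norm (hyp_term A B C E F k) \<le> M * of_nat k powr (- Re (E + F - A - B - C) - 1)"
proof -
  let ?s = "E + F - A - B - C"
  obtain M where M: "norm (hyp_term A B C E F k * (of_nat k * exp (?s * of_real (ln (of_nat k))))) \<le> M" for k
    using convergent_imp_Bseq[OF convergentI[OF hyp_term_asymptotics[of A B C E F]]]
    by (auto simp: Bseq_def)
  have "\<forall>\<^sub>F k in sequentially. norm (hyp_term A B C E F k) \<le> M * of_nat k powr (- Re ?s - 1)"
    using eventually_gt_at_top[of 0]
  proof eventually_elim
    case (elim k)
    have p: "(of_nat k :: real) * of_nat k powr Re ?s = inverse (of_nat k powr (- Re ?s - 1))"
    proof -
      have "- Re ?s - 1 = - (1 + Re ?s)" by simp
      thus ?thesis using elim by (simp only: powr_minus powr_add) simp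
    qed
    have "norm (hyp_term A B C E F k) * (of_nat k * of_nat k powr Re ?s) \<le> M"
      using M[of k] elim by (simp add: norm_mult powr_def mult_ac)
    thus ?case unfolding p using elim by (simp add: field_simps)
  qed
  thus ?thesis ..
qed

lemma summable_norm_hyp_term:
  assumes "Re (E + F - A - B - C) > 0"
  shows "summable (\<lambda>k. norm (hyp_term A B C E F k))"
proof -
  obtain M where "\<forall>\<^sub>F k in sequentially.
     norm (hyp_term A B C E F k) \<le> M * of_nat k powr (- Re (E + F - A - B - C) - 1)"
    using hyp_term_bound by blast
  then have "\<forall>\<^sub>F k in sequentially. norm (norm (hyp_term A B C E F k))
      \<le> M * of_nat k powr (- Re (E + F - A - B - C) - 1)"
    by (simp only: real_norm_def abs_norm_cancel)
  moreover have "summable (\<lambda>k. M * of_nat k powr (- Re (E + F - A - B - C) - 1))"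
    using assms by (intro summable_mult iffD2[OF summable_real_powr_iff]) linarith
  ultimately show ?thesis
    by (rule summable_comparison_test_ev)
qed

lemma summable_hyp_term:
  "Re (E + F - A - B - C) > 0 \<Longrightarrow> summable (hyp_term A B C E F)"
  using summable_norm_cancel[OF summable_norm_hyp_term] .

text \<open>For the boundary terms of telescoping sums, which need one unit of excess less than
  summability.\<close>

lemma tendsto_hyp_term_0:
  assumes "Re (E + F - A - B - C) > -1"
  shows "hyp_term A B C E F \<longlonglongrightarrow> 0"
proof -
  obtain M where M: "\<forall>\<^sub>F k in sequentially.
     norm (hyp_term A B C E F k) \<le> M * of_nat k powr (- Re (E + F - A - B - C) - 1)"
    using hyp_term_bound by blast
  have "(\<lambda>k. of_nat k powr (- Re (E + F - A - B - C) - 1)) \<longlonglongrightarrow> (0::real)"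
    using assms by (intro tendsto_neg_powr filterlim_real_sequentially) simp
  hence "(\<lambda>k. M * of_nat k powr (- Re (E + F - A - B - C) - 1)) \<longlonglongrightarrow> 0"
    by (rule tendsto_mult_right_zero)
  with M show ?thesis by (rule Lim_null_comparison)
qed

text \<open>For the second certificate, which is linear in the index; that factor costs one unit of
  excess.\<close>

lemma tendsto_of_nat_mult_hyp_term_0:
  assumes "Re (E + F - A - B - C) > 0"
  shows "(\<lambda>k. of_nat k * hyp_term A B C E F k) \<longlonglongrightarrow> 0"
proof -
  obtain M where M: "\<forall>\<^sub>F k in sequentially.
     norm (hyp_term A B C E F k) \<le> M * of_nat k powr (- Re (E + F - A - B - C) - 1)"
    using hyp_term_bound by blast
  have "(\<lambda>k. of_nat k powr (- Re (E + F - A - B - C))) \<longlonglongrightarrow> (0::real)"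
    using assms by (intro tendsto_neg_powr filterlim_real_sequentially) simp
  hence "(\<lambda>k. M * of_nat k powr (- Re (E + F - A - B - C))) \<longlonglongrightarrow> 0"
    by (rule tendsto_mult_right_zero)
  moreover have "\<forall>\<^sub>F k in sequentially.
      norm (of_nat k * hyp_term A B C E F k) \<le> M * of_nat k powr (- Re (E + F - A - B - C))"
    using M eventually_gt_at_top[of 0]
  proof eventually_elim
    case (elim k)
    have "of_nat k * norm (hyp_term A B C E F k) \<le>
        of_nat k * (M * of_nat k powr (- Re (E + F - A - B - C) - 1))"
      using elim by (intro mult_left_mono) auto
    also have "\<dots> = M * of_nat k powr (- Re (E + F - A - B - C))"
      using elim by (simp add: powr_diff)
    finally show ?case by (simp add: norm_mult)
  qed
  ultimately show ?thesis by (rule Lim_null_comparison[rotated])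
qed

section \<open>Two contiguous relations by telescoping\<close>

context
  fixes a b c :: complex and n :: nat
begin

text \<open>Every term in the two relations is a polynomial in \<open>a\<close>, \<open>b\<close>,
  \<open>c\<close>, \<open>n\<close> times this factor, which turns them into polynomial identities.
  The symbol in \<open>a\<close> has length \<open>n\<close> because the term with
  \<open>a - 1\<close> contains only \<open>(a - 1) * (a)_n\<close>.\<close>

private definition common :: complex where
  "common = pochhammer a n * pochhammer b (Suc n) * pochhammer c (Suc n) / fact (Suc n) *
     (rGamma (a - b + of_nat n + 2) * rGamma (a - c + of_nat n + 2))"

private lemma rGamma_step: "rGamma (z + 1 + of_nat n) = (z + of_nat n + 1) * rGamma (z + of_nat n + 2)"
  for z :: complex
  using rGamma_plus1[of "z + of_nat n + 1"] by (simp add: add_ac)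

private lemma term_pred: "hyp_term (a - 1) b c (a - b) (a - c) (Suc n) =
    (a - 1) * (a - b + of_nat n + 1) * (a - c + of_nat n + 1) * common"
  using pochhammer_rec[of "a - 1" n] rGamma_step[of "a - b"] rGamma_step[of "a - c"]
  by (simp add: hyp_term_def common_def add_ac del: fact_Suc pochhammer_Suc)

private lemma term_same: "hyp_term a b c (a - b) (a - c) (Suc n) =
    (a + of_nat n) * (a - b + of_nat n + 1) * (a - c + of_nat n + 1) * common"
  using pochhammer_Suc[of a n] rGamma_step[of "a - b"] rGamma_step[of "a - c"]
  by (simp add: hyp_term_def common_def add_ac del: fact_Suc)

private lemma term_same_shift: "hyp_term a b c (a + 1 - b) (a + 1 - c) (Suc n) = (a + of_nat n) * common"
  using pochhammer_Suc[of a n]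
  by (simp add: hyp_term_def common_def algebra_simps del: fact_Suc)

text \<open>The prefactor \<open>a\<close> completes \<open>(a + 1)_(n+1)\<close> to
  \<open>(a)_(n+2)\<close>, a multiple of \<open>(a)_n\<close>, so that \<open>a = 0\<close> needs
  no division.\<close>

private lemma term_succ_shift: "a * hyp_term (a + 1) b c (a + 1 - b) (a + 1 - c) (Suc n) =
    (a + of_nat n) * (a + of_nat n + 1) * common"
proof -
  have "a * pochhammer (a + 1) (Suc n) = pochhammer a n * (a + of_nat n) * (a + of_nat n + 1)"
    unfolding pochhammer_rec[of a "Suc n", symmetric]
    by (subst pochhammer_Suc, subst pochhammer_Suc) (simp add: add_ac)
  hence "a * hyp_term (a + 1) b c (a + 1 - b) (a + 1 - c) (Suc n) =
      pochhammer a n * (a + of_nat n) * (a + of_nat n + 1) * pochhammer b (Suc n) * pochhammer c (Suc n) /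
      fact (Suc n) * (rGamma (a + 1 - b + of_nat (Suc n)) * rGamma (a + 1 - c + of_nat (Suc n)))"
    unfolding hyp_term_def by (simp only: mult.assoc[symmetric] times_divide_eq_right)
  moreover have "a + 1 - z + of_nat (Suc n) = a - z + of_nat n + 2" for z
    by simp
  ultimately show ?thesis by (simp add: common_def mult_ac del: fact_Suc of_nat_Suc)
qed

private lemma certificate_Suc: "b * c * hyp_term a (b + 1) (c + 1) (a - b + 1) (a - c + 1) (Suc n) =
    (a + of_nat n) * (b + of_nat n + 1) * (c + of_nat n + 1) * common"
proof -
  have "z * pochhammer (z + 1) (Suc n) = pochhammer z (Suc n) * (z + of_nat n + 1)" for z :: complex
    unfolding pochhammer_rec[of z "Suc n", symmetric]
    by (subst pochhammer_Suc) (simp add: add_ac)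
  note shift = this
  have "b * c * hyp_term a (b + 1) (c + 1) (a - b + 1) (a - c + 1) (Suc n) =
      pochhammer a (Suc n) * (b * pochhammer (b + 1) (Suc n)) * (c * pochhammer (c + 1) (Suc n)) /
      fact (Suc n) * (rGamma (a - b + 1 + of_nat (Suc n)) * rGamma (a - c + 1 + of_nat (Suc n)))"
    unfolding hyp_term_def by (simp only: mult_ac times_divide_eq_right times_divide_eq_left)
  moreover have "a - z + 1 + of_nat (Suc n) = a - z + of_nat n + 2" for z
    by simp
  ultimately show ?thesis
    unfolding shift by (simp add: common_def pochhammer_Suc[of a n] mult_ac del: fact_Suc of_nat_Suc)
qed

private lemma certificate: "b * c * hyp_term a (b + 1) (c + 1) (a - b + 1) (a - c + 1) n =
    (of_nat n + 1) * (a - b + of_nat n + 1) * (a - c + of_nat n + 1) * common"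
proof -
  have frac: "x / fact n = (of_nat n + 1) * (x / fact (Suc n))" for x :: complex
    using of_nat_neq_0[where 'a = complex, of n] by (simp add: add.commute)
  have "hyp_term a (b + 1) (c + 1) (a - b + 1) (a - c + 1) n =
      (of_nat n + 1) * (pochhammer a n * pochhammer (b + 1) n * pochhammer (c + 1) n / fact (Suc n) *
      (rGamma (a - b + 1 + of_nat n) * rGamma (a - c + 1 + of_nat n)))"
    using frac by (simp add: hyp_term_def)
  thus ?thesis
    unfolding rGamma_step common_def pochhammer_rec by (simp only: mult_ac times_divide_eq_right times_divide_eq_left)
qed

text \<open>The right-hand sides below are certificates found with Gosper's algorithm.\<close>

lemma dixon_telescope1:
  "hyp_term (a - 1) b c (a - b) (a - c) (Suc n) - a * (a - b - c) *
     (2 * hyp_term (a + 1) b c (a + 1 - b) (a + 1 - c) (Suc n) -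
      hyp_term a b c (a + 1 - b) (a + 1 - c) (Suc n)) =
   b * c * hyp_term a (b + 1) (c + 1) (a - b + 1) (a - c + 1) (Suc n) -
   b * c * hyp_term a (b + 1) (c + 1) (a - b + 1) (a - c + 1) n"
  unfolding term_pred certificate_Suc certificate using term_same_shift term_succ_shift by algebra

lemma dixon_telescope2:
  "(a - 2 * b - 2 * c) * (2 * hyp_term a b c (a - b) (a - c) (Suc n) -
      hyp_term (a - 1) b c (a - b) (a - c) (Suc n)) -
   (a - 2 * b) * (a - 2 * c) * (a - b - c) * hyp_term a b c (a + 1 - b) (a + 1 - c) (Suc n) =
   (2 * (b + c) - 3 * a - 2 * of_nat (Suc n)) * (b * c * hyp_term a (b + 1) (c + 1) (a - b + 1) (a - c + 1) (Suc n)) -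
   (2 * (b + c) - 3 * a - 2 * of_nat n) * (b * c * hyp_term a (b + 1) (c + 1) (a - b + 1) (a - c + 1) n)"
  unfolding term_pred term_same term_same_shift certificate_Suc certificate of_nat_Suc by algebra

end

text \<open>The term at \<open>k = 0\<close> already equals the certificate at 0, because
  \<open>(a - b) * (a - c) - a * (a - b - c) = b * c\<close>. Hence no lower boundary term
  remains.\<close>

lemma dixon_sum_telescope1:
  "(\<Sum>k\<le>n. hyp_term (a - 1) b c (a - b) (a - c) k - a * (a - b - c) *
     (2 * hyp_term (a + 1) b c (a + 1 - b) (a + 1 - c) k -
      hyp_term a b c (a + 1 - b) (a + 1 - c) k)) =
   b * c * hyp_term a (b + 1) (c + 1) (a - b + 1) (a - c + 1) n"
proof (induction n)
  case 0
  have "rGamma (a - z) = (a - z) * rGamma (a - z + 1)" for z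
    by (rule rGamma_plus1[symmetric])
  from this[of b] this[of c] show ?case
    by (simp add: hyp_term_def diff_add_eq) (simp add: algebra_simps)
next
  case (Suc n)
  show ?case
    unfolding sum.atMost_Suc Suc dixon_telescope1 by simp
qed

lemma dixon_sum_telescope2:
  "(\<Sum>k\<le>n. (a - 2 * b - 2 * c) * (2 * hyp_term a b c (a - b) (a - c) k -
      hyp_term (a - 1) b c (a - b) (a - c) k) -
   (a - 2 * b) * (a - 2 * c) * (a - b - c) * hyp_term a b c (a + 1 - b) (a + 1 - c) k) =
   (2 * (b + c) - 3 * a - 2 * of_nat n) * (b * c * hyp_term a (b + 1) (c + 1) (a - b + 1) (a - c + 1) n)"
proof (induction n)
  case 0
  have "rGamma (a - z) = (a - z) * rGamma (a - z + 1)" for z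
    by (rule rGamma_plus1[symmetric])
  from this[of b] this[of c] show ?case
    by (simp add: hyp_term_def diff_add_eq) (simp add: algebra_simps)
next
  case (Suc n)
  show ?case
    unfolding sum.atMost_Suc Suc dixon_telescope2 by simp
qed

lemma sums_of_telescope:
  fixes f g :: "nat \<Rightarrow> 'a :: real_normed_vector"
  assumes "\<And>n. (\<Sum>k\<le>n. f k) = g n" "g \<longlonglongrightarrow> 0"
  shows "f sums 0"
  using assms by (simp add: sums_def_le)

text \<open>Dixon's series at \<open>a\<close> on the left, the companion at \<open>a + 1\<close> in
  the bracket. The boundary term has excess \<open>a - 2 * b - 2 * c\<close>, the least convergent
  series one more, so both need the same bound.\<close>

lemma dixon_contiguous1:
  assumes "Re (a - 2 * b - 2 * c) > -1"
  shows "hyp_reg (a - 1) b c (a - b) (a - c) = a * (a - b - c) *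
     (2 * hyp_reg (a + 1) b c (a + 1 - b) (a + 1 - c) -
      hyp_reg a b c (a + 1 - b) (a + 1 - c))"
proof -
  have "hyp_term (a - 1) b c (a - b) (a - c) sums hyp_reg (a - 1) b c (a - b) (a - c)"
       "hyp_term (a + 1) b c (a + 1 - b) (a + 1 - c) sums hyp_reg (a + 1) b c (a + 1 - b) (a + 1 - c)"
       "hyp_term a b c (a + 1 - b) (a + 1 - c) sums hyp_reg a b c (a + 1 - b) (a + 1 - c)"
    using assms unfolding hyp_reg_def
    by (intro summable_sums summable_hyp_term; simp)+
  hence "(\<lambda>k. hyp_term (a - 1) b c (a - b) (a - c) k - a * (a - b - c) *
     (2 * hyp_term (a + 1) b c (a + 1 - b) (a + 1 - c) k -
      hyp_term a b c (a + 1 - b) (a + 1 - c) k)) sums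
     (hyp_reg (a - 1) b c (a - b) (a - c) - a * (a - b - c) *
     (2 * hyp_reg (a + 1) b c (a + 1 - b) (a + 1 - c) -
      hyp_reg a b c (a + 1 - b) (a + 1 - c)))"
    by (intro sums_diff sums_mult)
  moreover have "(\<lambda>k. hyp_term (a - 1) b c (a - b) (a - c) k - a * (a - b - c) *
     (2 * hyp_term (a + 1) b c (a + 1 - b) (a + 1 - c) k -
      hyp_term a b c (a + 1 - b) (a + 1 - c) k)) sums 0"
    using assms
    by (intro sums_of_telescope[OF dixon_sum_telescope1] tendsto_mult_right_zero tendsto_hyp_term_0) simp
  ultimately show ?thesis using sums_unique2 by fastforce
qed

text \<open>The companion at \<open>a\<close> on the left, Dixon's series at \<open>a + 1\<close> on
  the right. The bound is one unit stronger than before: the first series has excess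
  \<open>a - 2 * b - 2 * c\<close>, and the certificate carries a linear factor.\<close>

lemma dixon_contiguous2:
  assumes "Re (a - 2 * b - 2 * c) > 0"
  shows "(a - 2 * b - 2 * c) * (2 * hyp_reg a b c (a - b) (a - c) - hyp_reg (a - 1) b c (a - b) (a - c)) =
   (a - 2 * b) * (a - 2 * c) * (a - b - c) * hyp_reg a b c (a + 1 - b) (a + 1 - c)"
proof -
  have "hyp_term (a - 1) b c (a - b) (a - c) sums hyp_reg (a - 1) b c (a - b) (a - c)"
       "hyp_term a b c (a - b) (a - c) sums hyp_reg a b c (a - b) (a - c)"
       "hyp_term a b c (a + 1 - b) (a + 1 - c) sums hyp_reg a b c (a + 1 - b) (a + 1 - c)"
    using assms unfolding hyp_reg_def
    by (intro summable_sums summable_hyp_term; simp)+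
  hence "(\<lambda>k. (a - 2 * b - 2 * c) * (2 * hyp_term a b c (a - b) (a - c) k -
      hyp_term (a - 1) b c (a - b) (a - c) k) -
   (a - 2 * b) * (a - 2 * c) * (a - b - c) * hyp_term a b c (a + 1 - b) (a + 1 - c) k) sums
     ((a - 2 * b - 2 * c) * (2 * hyp_reg a b c (a - b) (a - c) - hyp_reg (a - 1) b c (a - b) (a - c)) -
   (a - 2 * b) * (a - 2 * c) * (a - b - c) * hyp_reg a b c (a + 1 - b) (a + 1 - c))"
    by (intro sums_diff sums_mult)
  moreover have "(\<lambda>k. (a - 2 * b - 2 * c) * (2 * hyp_term a b c (a - b) (a - c) k -
      hyp_term (a - 1) b c (a - b) (a - c) k) -
   (a - 2 * b) * (a - 2 * c) * (a - b - c) * hyp_term a b c (a + 1 - b) (a + 1 - c) k) sums 0"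
  proof (rule sums_of_telescope[OF dixon_sum_telescope2])
    let ?h = "hyp_term a (b + 1) (c + 1) (a - b + 1) (a - c + 1)"
    have "(\<lambda>n. (2 * (b + c) - 3 * a) * b * c * ?h n - 2 * b * c * (of_nat n * ?h n)) \<longlonglongrightarrow> 0 - 0"
      using assms
      by (intro tendsto_diff tendsto_mult_right_zero tendsto_hyp_term_0 tendsto_of_nat_mult_hyp_term_0) simp_all
    thus "(\<lambda>n. (2 * (b + c) - 3 * a - 2 * of_nat n) * (b * c * ?h n)) \<longlonglongrightarrow> 0"
      by (simp add: algebra_simps)
  qed
  ultimately show ?thesis using sums_unique2 by fastforce
qed

lemma hyp_reg_contiguous:
  assumes "Re (E + F - A - B - C) > 0"
  shows "hyp_reg A B C E F = hyp_reg (A - 1) B C E F + B * C * hyp_reg A (B + 1) (C + 1) (E + 1) (F + 1)"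
proof -
  have sm: "summable (hyp_term A B C E F)" "summable (hyp_term (A - 1) B C E F)"
       "summable (hyp_term A (B + 1) (C + 1) (E + 1) (F + 1))"
    using assms by (intro summable_hyp_term; simp)+
  have "hyp_term A B C E F (Suc k) - hyp_term (A - 1) B C E F (Suc k) =
      B * C * hyp_term A (B + 1) (C + 1) (E + 1) (F + 1) k" for k
  proof -
    have "pochhammer A (Suc k) - pochhammer (A - 1) (Suc k) = of_nat (Suc k) * pochhammer A k"
      using pochhammer_rec[of "A - 1" k] pochhammer_Suc[of A k] by (simp add: algebra_simps)
    hence "hyp_term A B C E F (Suc k) - hyp_term (A - 1) B C E F (Suc k) =
       of_nat (Suc k) * pochhammer A k * pochhammer B (Suc k) * pochhammer C (Suc k) / fact (Suc k) *
       (rGamma (E + of_nat (Suc k)) * rGamma (F + of_nat (Suc k)))"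
      unfolding hyp_term_def by (simp add: field_simps del: of_nat_Suc fact_Suc)
    also have "\<dots> = B * C * hyp_term A (B + 1) (C + 1) (E + 1) (F + 1) k"
      using of_nat_neq_0[where 'a = complex, of k]
      by (simp add: hyp_term_def pochhammer_rec add_ac)
    finally show ?thesis .
  qed
  moreover have "hyp_term A B C E F 0 - hyp_term (A - 1) B C E F 0 = 0"
    by (simp add: hyp_term_def)
  ultimately have "(\<Sum>k. hyp_term A B C E F k - hyp_term (A - 1) B C E F k) =
      (\<Sum>k. B * C * hyp_term A (B + 1) (C + 1) (E + 1) (F + 1) k)"
    using suminf_split_head[OF summable_diff[OF sm(1,2)]] by simp
  thus ?thesis
    unfolding hyp_reg_def
    using suminf_diff[OF sm(1,2)] suminf_mult[OF sm(3), of "B * C"] by (simp add: algebra_simps)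
qed

section \<open>Domination and the limit of the series as its parameters grow\<close>

lemma pochhammer_nonneg': "x \<ge> 0 \<Longrightarrow> pochhammer x k \<ge> 0" for x :: real
  by (auto simp: pochhammer_prod intro: prod_nonneg)

lemma norm_pochhammer_le: "norm (pochhammer z k) \<le> pochhammer (norm z) k"
  for z :: complex
proof (induction k)
  case (Suc k)
  have "norm (z + of_nat k) \<le> norm z + of_nat k"
    by (metis norm_triangle_ineq norm_of_nat)
  with Suc show ?case
    by (simp add: pochhammer_Suc norm_mult mult_mono pochhammer_nonneg')
qed simp

lemma norm_pochhammer_ge:
  assumes "M > 0" "M \<le> Re z"
  shows "pochhammer M k \<le> norm (pochhammer z k)"
proof (induction k)
  case (Suc k)
  have "M + of_nat k \<le> norm (z + of_nat k)"
    using complex_Re_le_cmod[of "z + of_nat k"] assms by simp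
  with Suc show ?case
    using assms by (simp add: pochhammer_Suc norm_mult mult_mono pochhammer_nonneg')
qed simp

text \<open>Factorwise, \<open>(w + k) / (z + k) = 1 + (w - z) / (z + k)\<close>. For fixed
  \<open>M\<close> the bound sees only the difference \<open>w - z\<close>, so it is uniform under a
  common shift of both.\<close>

lemma norm_pochhammer_quotient_le:
  fixes w z :: complex
  assumes "M > 0" "M \<le> Re z"
  shows "norm (pochhammer w k / pochhammer z k) \<le> pochhammer (M + norm (w - z)) k / pochhammer M k"
proof (induction k)
  case (Suc k)
  have ge: "M + of_nat k \<le> norm (z + of_nat k)"
    using complex_Re_le_cmod[of "z + of_nat k"] assms by simp
  have pos: "M + of_nat k > 0" using assms by simp
  have "norm (w + of_nat k) \<le> norm (z + of_nat k) + norm (w - z)"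
    using norm_triangle_ineq[of "z + of_nat k" "w - z"] by (simp add: add.commute)
  hence "norm (w + of_nat k) / norm (z + of_nat k) \<le>
      (norm (z + of_nat k) + norm (w - z)) / norm (z + of_nat k)"
    by (rule divide_right_mono) simp
  hence "norm ((w + of_nat k) / (z + of_nat k)) \<le> 1 + norm (w - z) / norm (z + of_nat k)"
    using ge pos unfolding norm_divide by (auto simp: add_divide_distrib split: if_splits)
  also have "\<dots> \<le> 1 + norm (w - z) / (M + of_nat k)"
    using ge pos by (intro add_left_mono divide_left_mono mult_pos_pos) auto
  also have "\<dots> = (M + norm (w - z) + of_nat k) / (M + of_nat k)"
    using pos by (simp add: field_simps)
  finally have "norm (pochhammer w k / pochhammer z k) * norm ((w + of_nat k) / (z + of_nat k)) \<le>
     pochhammer (M + norm (w - z)) k / pochhammer M k * ((M + norm (w - z) + of_nat k) / (M + of_nat k))"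
    using Suc assms by (intro mult_mono) (auto intro!: divide_nonneg_nonneg pochhammer_nonneg' add_pos_nonneg)
  thus ?case by (simp add: pochhammer_Suc norm_mult norm_divide)
qed simp

lemma filterlim_shift_at_infinity:
  "filterlim (\<lambda>n. z + of_nat (2 * n) :: complex) at_infinity sequentially"
proof (rule tendsto_add_filterlim_at_infinity[OF tendsto_const])
  have "filterlim (\<lambda>n. 2 * n) sequentially (sequentially :: nat filter)"
    by (rule filterlim_subseq) (simp add: strict_mono_def)
  thus "filterlim (\<lambda>n. of_nat (2 * n) :: complex) at_infinity sequentially"
    by (rule filterlim_compose[OF tendsto_of_nat])
qed

lemma tendsto_inverse_shift: "(\<lambda>n. inverse (z + of_nat (2 * n) :: complex)) \<longlonglongrightarrow> 0"
  by (rule filterlim_compose[OF tendsto_inverse_0 filterlim_shift_at_infinity])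

lemma tendsto_pochhammer_quotient:
  fixes A E :: complex
  shows "(\<lambda>n. pochhammer (A + of_nat (2 * n)) k / pochhammer (E + of_nat (2 * n)) k) \<longlonglongrightarrow> 1"
proof (induction k)
  case (Suc k)
  have "(\<lambda>n. (A + of_nat (2 * n) + of_nat k) / (E + of_nat (2 * n) + of_nat k)) \<longlonglongrightarrow> 1"
  proof (rule Lim_transform_eventually)
    show "(\<lambda>n. 1 + (A - E) * inverse ((E + of_nat k) + of_nat (2 * n))) \<longlonglongrightarrow> 1"
      using tendsto_add[OF tendsto_const[of 1]
          tendsto_mult_right_zero[OF tendsto_inverse_shift[of "E + of_nat k"], of "A - E"]] by simp
    show "\<forall>\<^sub>F n in sequentially. 1 + (A - E) * inverse ((E + of_nat k) + of_nat (2 * n)) =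
        (A + of_nat (2 * n) + of_nat k) / (E + of_nat (2 * n) + of_nat k)"
      using filterlim_at_infinity_imp_eventually_ne[OF filterlim_shift_at_infinity[of "E + of_nat k"], of 0]
      by eventually_elim (simp add: field_simps)
  qed
  from tendsto_mult[OF Suc this] show ?case by (simp add: pochhammer_Suc)
qed simp

lemma tendsto_inverse_pochhammer:
  fixes F :: complex
  shows "(\<lambda>n. inverse (pochhammer (F + of_nat (2 * n)) k)) \<longlonglongrightarrow> (if k = 0 then 1 else 0)"
proof (induction k)
  case (Suc k)
  from tendsto_mult[OF Suc tendsto_inverse_shift[of "F + of_nat k"]]
  show ?case by (simp add: pochhammer_Suc add_ac)
qed simp

text \<open>Up to a constant the majorant is the norm of a \<open>hyp_term\<close> with real
  parameters and \<open>E = F = M\<close>, whose excess is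
  \<open>M - \<beta> - B - C\<close>.\<close>

lemma summable_majorant:
  assumes "\<beta> \<ge> 0" "B \<ge> 0" "C \<ge> 0" "M > \<beta> + B + C"
  shows "summable (\<lambda>k. pochhammer (M + \<beta>) k / pochhammer M k * (pochhammer B k / pochhammer M k) *
     (pochhammer C k / fact k :: real))"
proof -
  define r where "r = rGamma (complex_of_real M)"
  have M: "M > 0" using assms by simp
  hence nz: "complex_of_real M \<notin> \<int>\<^sub>\<le>\<^sub>0"
    by (auto elim!: nonpos_Ints_cases' dest: arg_cong[of _ _ Re])
  hence r: "r \<noteq> 0" by (simp add: r_def rGamma_eq_zero_iff)
  have "summable (\<lambda>k. norm (hyp_term (of_real (M + \<beta>)) (of_real B) (of_real C) (of_real M) (of_real M) k))"
    using assms by (intro summable_norm_hyp_term) simp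
  also have "(\<lambda>k. norm (hyp_term (of_real (M + \<beta>)) (of_real B) (of_real C) (of_real M) (of_real M) k)) =
     (\<lambda>k. (norm r)\<^sup>2 * (pochhammer (M + \<beta>) k / pochhammer M k * (pochhammer B k / pochhammer M k) *
     (pochhammer C k / fact k)))"
  proof
    fix k
    have p: "pochhammer M k > 0" using M by (rule pochhammer_pos)
    have "r = of_real (pochhammer M k) * rGamma (of_real M + of_nat k)"
      unfolding r_def by (subst pochhammer_rGamma[of _ k]) (simp add: pochhammer_of_real)
    hence "rGamma (of_real M + of_nat k) = r / of_real (pochhammer M k)"
      using p by (simp add: field_simps)
    thus "norm (hyp_term (of_real (M + \<beta>)) (of_real B) (of_real C) (of_real M) (of_real M) k) =
      (norm r)\<^sup>2 * (pochhammer (M + \<beta>) k / pochhammer M k * (pochhammer B k / pochhammer M k) *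
     (pochhammer C k / fact k))"
      unfolding hyp_term_def pochhammer_of_real
      using assms p M by (simp add: norm_mult norm_divide pochhammer_nonneg' power2_eq_square mult_ac)
  qed
  finally show ?thesis using r by (simp only: summable_cmult_iff) simp
qed

text \<open>Two growing Pochhammer symbols below face one above, so each term with k > 0 tends to 0;
  Tannery's theorem lets the limit pass through the sum.\<close>

lemma tendsto_hyp_shift:
  fixes A B C E F :: complex
  shows "(\<lambda>n. \<Sum>k. pochhammer (A + of_nat (2 * n)) k * pochhammer B k * pochhammer C k /
     (pochhammer (E + of_nat (2 * n)) k * pochhammer (F + of_nat (2 * n)) k * fact k)) \<longlonglongrightarrow> 1"
proof -
  define f where "f k n = pochhammer (A + of_nat (2 * n)) k / pochhammer (E + of_nat (2 * n)) k *
     (pochhammer B k / pochhammer (F + of_nat (2 * n)) k) * (pochhammer C k / fact k)" for k n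
  \<comment> \<open>This choice gives the majorant excess exactly 1.\<close>
  define M where "M = 1 + norm (A - E) + norm B + norm C"
  define D where "D k = pochhammer (M + norm (A - E)) k / pochhammer M k *
     (pochhammer (norm B) k / pochhammer M k) * (pochhammer (norm C) k / fact k)" for k
  have M: "M > 0" by (simp add: M_def add_pos_nonneg)
  have lim: "f k \<longlonglongrightarrow> (if k = 0 then 1 else 0)" for k
  proof -
    have "f k \<longlonglongrightarrow> 1 * (pochhammer B k * (if k = 0 then 1 else 0)) * (pochhammer C k / fact k)"
      unfolding f_def divide_inverse[of "pochhammer B k"]
      by (intro tendsto_mult tendsto_const tendsto_pochhammer_quotient tendsto_inverse_pochhammer)
    thus ?thesis by (cases "k = 0") simp_all
  qed
  obtain n0 :: nat where n0: "max (M - Re E) (M - Re F) < of_nat n0"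
    using reals_Archimedean2 by blast
  have "\<forall>\<^sub>F n in sequentially. M \<le> Re E + of_nat n \<and> M \<le> Re F + of_nat n"
    using eventually_ge_at_top[of n0] by eventually_elim (use n0 in auto)
  hence "\<forall>\<^sub>F n in sequentially. \<forall>k. norm (f k n) \<le> D k"
  proof eventually_elim
    case (elim n)
    have E: "M \<le> Re (E + of_nat (2 * n))" and F: "M \<le> Re (F + of_nat (2 * n))"
      using elim by simp_all
    have "norm (f k n) \<le> D k" for k
    proof -
      have 1: "norm (pochhammer (A + of_nat (2 * n)) k / pochhammer (E + of_nat (2 * n)) k) \<le>
          pochhammer (M + norm (A - E)) k / pochhammer M k"
        using norm_pochhammer_quotient_le[OF M E, of "A + of_nat (2 * n)" k] by simp
      have 2: "norm (pochhammer B k / pochhammer (F + of_nat (2 * n)) k) \<le>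
          pochhammer (norm B) k / pochhammer M k"
        unfolding norm_divide
        by (intro frac_le norm_pochhammer_le norm_pochhammer_ge M F pochhammer_pos pochhammer_nonneg') auto
      have 3: "norm (pochhammer C k / fact k :: complex) \<le> pochhammer (norm C) k / fact k"
        by (simp add: norm_divide norm_pochhammer_le divide_right_mono)
      show ?thesis
        unfolding f_def D_def norm_mult[of _ "pochhammer C k / fact k"] norm_mult[of "_ / _" "pochhammer B k / _"]
        using M by (intro mult_mono 1 2 3 mult_nonneg_nonneg divide_nonneg_nonneg pochhammer_nonneg'
            norm_ge_zero) (auto intro: add_pos_nonneg)
    qed
    thus ?case ..
  qed
  hence bound: "\<forall>\<^sub>F (k, n) in at_top \<times>\<^sub>F sequentially. norm (f k n) \<le> D k"
    using eventually_prod2[of sequentially "\<lambda>n. \<forall>k. norm (f k n) \<le> D k" sequentially]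
    by (auto elim!: eventually_mono)
  have "summable D"
    unfolding D_def by (intro summable_majorant) (auto simp: M_def)
  from tannerys_theorem[OF lim bound this] have "(\<lambda>n. \<Sum>k. f k n) \<longlonglongrightarrow> (\<Sum>k. if k = 0 then 1 else 0)"
    by simp
  also have "(\<Sum>k. if k = 0 then 1 else 0 :: complex) = 1"
    using suminf_finite[of "{0}" "\<lambda>k. if k = 0 then 1 else 0 :: complex"] by simp
  finally show ?thesis unfolding f_def by (simp add: mult_ac)
qed

section \<open>Dixon's theorem and its companion\<close>

text \<open>Dixon's product is the case \<open>u = a / 2\<close>, \<open>v = (a + 1) / 2\<close>, and its companion has \<open>u\<close> and \<open>v\<close>
  exchanged. The factor before \<open>Gamma (v - b - c)\<close> is \<open>Gamma v / Gamma a\<close>, rewritten by Legendre's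
  duplication formula to have no poles.\<close>

definition dixon_prod :: "complex \<Rightarrow> complex \<Rightarrow> complex \<Rightarrow> complex \<Rightarrow> complex \<Rightarrow> complex" where
  "dixon_prod a u v b c = exp ((1 - a) * of_real (ln 2)) * of_real (sqrt pi) * rGamma u * Gamma (v - b - c) *
     (rGamma (v - b) * rGamma (v - c) * rGamma (a - b - c))"

text \<open>Converts between the Gamma quotients of the final formula and the factors of
  \<open>dixon_prod\<close>. The assumption says that neither \<open>a / 2\<close> nor
  \<open>(a + 1) / 2\<close> is a pole of Gamma.\<close>

lemma Gamma_half_quotient:
  fixes a :: complex
  assumes "a \<notin> \<int>\<^sub>\<le>\<^sub>0"
  shows "Gamma ((a + 1) / 2) * rGamma a = exp ((1 - a) * of_real (ln 2)) * of_real (sqrt pi) * rGamma (a / 2)"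
    and "Gamma (a / 2) * rGamma a = exp ((1 - a) * of_real (ln 2)) * of_real (sqrt pi) * rGamma ((a + 1) / 2)"
proof -
  have 1: "a / 2 \<notin> \<int>\<^sub>\<le>\<^sub>0" "a / 2 + 1 / 2 \<notin> \<int>\<^sub>\<le>\<^sub>0"
  proof -
    show "a / 2 \<notin> \<int>\<^sub>\<le>\<^sub>0"
    proof
      assume "a / 2 \<in> \<int>\<^sub>\<le>\<^sub>0"
      then obtain n where "a / 2 = - of_nat n" by (elim nonpos_Ints_cases')
      hence "a = - of_nat (2 * n)" by (simp add: field_simps)
      thus False using assms by (metis minus_of_nat_in_nonpos_Ints)
    qed
    show "a / 2 + 1 / 2 \<notin> \<int>\<^sub>\<le>\<^sub>0"
    proof
      assume "a / 2 + 1 / 2 \<in> \<int>\<^sub>\<le>\<^sub>0"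
      then obtain n where "a / 2 + 1 / 2 = - of_nat n" by (elim nonpos_Ints_cases')
      moreover have "a = 2 * (a / 2 + 1 / 2) - 1" by simp
      ultimately have "a = - of_nat (2 * n + 1)" by simp
      thus False using assms by (metis minus_of_nat_in_nonpos_Ints)
    qed
  qed
  have nz: "Gamma a \<noteq> 0" "Gamma (a / 2) \<noteq> 0" "Gamma (a / 2 + 1 / 2) \<noteq> 0"
    using assms 1 by (simp_all add: Gamma_eq_zero_iff)
  note dup = Gamma_legendre_duplication[OF 1]
  have h: "(a + 1) / 2 = a / 2 + 1 / 2" by (simp add: add_divide_distrib)
  show "Gamma ((a + 1) / 2) * rGamma a = exp ((1 - a) * of_real (ln 2)) * of_real (sqrt pi) * rGamma (a / 2)"
    and "Gamma (a / 2) * rGamma a = exp ((1 - a) * of_real (ln 2)) * of_real (sqrt pi) * rGamma ((a + 1) / 2)"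
    unfolding h using dup nz by (simp_all add: rGamma_inverse_Gamma field_simps)
qed

lemma exp_ln2_step: "exp ((1 - (a + 2)) * of_real (ln 2)) = exp ((1 - a) * of_real (ln 2)) / (4 :: complex)"
proof -
  have "exp ((1 - (a + 2)) * of_real (ln 2)) * exp (2 * of_real (ln 2)) =
      exp ((1 - a) * complex_of_real (ln 2))"
    by (subst exp_add[symmetric]) (simp add: algebra_simps)
  moreover have "exp (2 * complex_of_real (ln 2)) = 4"
    by (simp add: exp_double exp_of_real)
  ultimately show ?thesis by (simp add: field_simps)
qed

lemma dixon_prod_shift2:
  assumes "v - b - c \<notin> \<int>\<^sub>\<le>\<^sub>0"
  shows "(v - b - c) * dixon_prod a u v b c =
    4 * u * (v - b) * (v - c) * (a - b - c) * (a + 1 - b - c) * dixon_prod (a + 2) (u + 1) (v + 1) b c"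
proof -
  have G: "Gamma (v + 1 - b - c) = (v - b - c) * Gamma (v - b - c)"
    using Gamma_plus1[OF assms] by (simp add: algebra_simps)
  have R: "rGamma u = u * rGamma (u + 1)"
    "rGamma (v - b) = (v - b) * rGamma (v + 1 - b)"
    "rGamma (v - c) = (v - c) * rGamma (v + 1 - c)"
    "rGamma (a - b - c) = (a - b - c) * ((a + 1 - b - c) * rGamma (a + 2 - b - c))"
    using rGamma_plus1[of u] rGamma_plus1[of "v - b"] rGamma_plus1[of "v - c"]
      rGamma_plus1[of "a - b - c"] rGamma_plus1[of "a - b - c + 1"]
    by (simp_all add: algebra_simps)
  show ?thesis
    unfolding dixon_prod_def exp_ln2_step G R by simp
qed

text \<open>For \<open>u = (a + 1) / 2\<close> and \<open>v = a / 2\<close> this leads from the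
  companion product at \<open>a\<close> to Dixon's product at \<open>a + 1\<close>: the unchanged
  \<open>u\<close> is half of the new \<open>a\<close>.\<close>

lemma dixon_prod_shift1:
  assumes "v - b - c \<notin> \<int>\<^sub>\<le>\<^sub>0"
  shows "(v - b - c) * dixon_prod a u v b c =
    2 * (v - b) * (v - c) * (a - b - c) * dixon_prod (a + 1) u (v + 1) b c"
proof -
  have G: "Gamma (v + 1 - b - c) = (v - b - c) * Gamma (v - b - c)"
    using Gamma_plus1[OF assms] by (simp add: algebra_simps)
  have R:
    "rGamma (v - b) = (v - b) * rGamma (v + 1 - b)"
    "rGamma (v - c) = (v - c) * rGamma (v + 1 - c)"
    "rGamma (a - b - c) = (a - b - c) * rGamma (a + 1 - b - c)"
    using rGamma_plus1[of "v - b"] rGamma_plus1[of "v - c"] rGamma_plus1[of "a - b - c"]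
    by (simp_all add: algebra_simps)
  have E: "exp ((1 - (a + 1)) * of_real (ln 2)) = exp ((1 - a) * of_real (ln 2)) / (2 :: complex)"
  proof -
    have "exp ((1 - (a + 1)) * of_real (ln 2)) * exp (of_real (ln 2)) =
        exp ((1 - a) * complex_of_real (ln 2))"
      by (subst exp_add[symmetric]) (simp add: algebra_simps)
    moreover have "exp (complex_of_real (ln 2)) = 2"
      by (simp add: exp_of_real)
    ultimately show ?thesis by (simp add: field_simps)
  qed
  show ?thesis
    unfolding dixon_prod_def E G R by simp
qed

text \<open>With Legendre's formula undone, the quotient splits into two balanced ones:
  \<open>(v - b) + (v - c) = v + (v - b - c)\<close> in steps of \<open>n\<close>, and
  \<open>a + (a - b - c) = (a - b) + (a - c)\<close> in steps of \<open>2 * n\<close>.\<close>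

lemma dixon_prod_asymptotics:
  "(\<lambda>n. dixon_prod (a + of_nat (2 * n)) (a / 2 + of_nat n) ((a + 1) / 2 + of_nat n) b c /
     (rGamma (a - b + of_nat (2 * n)) * rGamma (a - c + of_nat (2 * n)))) \<longlonglongrightarrow> 1"
proof -
  let ?v = "(a + 1) / 2"
  have sub: "filterlim (\<lambda>n. 2 * n) sequentially (sequentially :: nat filter)"
    by (rule filterlim_subseq) (simp add: strict_mono_def)
  have 1: "(\<lambda>n. rGamma (?v - b + of_nat n) * rGamma (?v - c + of_nat n) /
      (rGamma (?v + of_nat n) * rGamma (?v - b - c + of_nat n))) \<longlonglongrightarrow> 1"
    by (rule rGamma_quotient_limit) (simp add: algebra_simps)
  have 2: "(\<lambda>n. rGamma (a + of_nat (2 * n)) * rGamma (a - b - c + of_nat (2 * n)) /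
      (rGamma (a - b + of_nat (2 * n)) * rGamma (a - c + of_nat (2 * n)))) \<longlonglongrightarrow> 1"
    using filterlim_compose[OF rGamma_quotient_limit[of a "a - b - c" "a - b" "a - c"] sub] by simp
  have "\<forall>\<^sub>F n in sequentially. rGamma (a + of_nat (2 * n)) \<noteq> 0"
    by (rule eventually_compose_filterlim[OF rGamma_shift_nonzero sub])
  hence "\<forall>\<^sub>F n in sequentially.
     rGamma (?v - b + of_nat n) * rGamma (?v - c + of_nat n) /
      (rGamma (?v + of_nat n) * rGamma (?v - b - c + of_nat n)) *
     (rGamma (a + of_nat (2 * n)) * rGamma (a - b - c + of_nat (2 * n)) /
      (rGamma (a - b + of_nat (2 * n)) * rGamma (a - c + of_nat (2 * n)))) =
     dixon_prod (a + of_nat (2 * n)) (a / 2 + of_nat n) (?v + of_nat n) b c /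
     (rGamma (a - b + of_nat (2 * n)) * rGamma (a - c + of_nat (2 * n)))"
  proof eventually_elim
    case (elim n)
    let ?a = "a + of_nat (2 * n)"
    have "?a \<notin> \<int>\<^sub>\<le>\<^sub>0" using elim by (simp add: rGamma_eq_zero_iff)
    note half = Gamma_half_quotient(1)[OF this]
    have e: "?a / 2 = a / 2 + of_nat n" "(?a + 1) / 2 = ?v + of_nat n"
      "?a - b - c = a - b - c + of_nat (2 * n)" "?v + of_nat n - b = ?v - b + of_nat n"
      "?v + of_nat n - c = ?v - c + of_nat n" "?v - b + of_nat n - c = ?v - b - c + of_nat n"
      by (simp_all add: field_simps)
    show ?case
      unfolding dixon_prod_def half[unfolded e(1,2), symmetric] e(3-6) Gamma_def
      unfolding divide_inverse inverse_mult_distrib by (simp only: mult_ac)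
  qed
  from Lim_transform_eventually[OF tendsto_mult[OF 1 2] this] show ?thesis by simp
qed

lemma hyp_reg_shift_asymptotics:
  "(\<lambda>n. hyp_reg (a - 1 + of_nat (2 * n)) b c (a - b + of_nat (2 * n)) (a - c + of_nat (2 * n)) /
     (rGamma (a - b + of_nat (2 * n)) * rGamma (a - c + of_nat (2 * n)))) \<longlonglongrightarrow> 1"
proof -
  have sub: "filterlim (\<lambda>n. 2 * n) sequentially (sequentially :: nat filter)"
    by (rule filterlim_subseq) (simp add: strict_mono_def)
  have "\<forall>\<^sub>F n in sequentially. rGamma (a - b + of_nat (2 * n)) \<noteq> 0"
       "\<forall>\<^sub>F n in sequentially. rGamma (a - c + of_nat (2 * n)) \<noteq> 0"
    by (rule eventually_compose_filterlim[OF rGamma_shift_nonzero sub])+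
  moreover obtain n0 :: nat where n0: "- Re (a - 2 * b - 2 * c) < of_nat n0"
    using reals_Archimedean2 by blast
  have "\<forall>\<^sub>F n in sequentially. Re (a - 2 * b - 2 * c) + 2 * of_nat n > 0"
    using eventually_ge_at_top[of n0] by eventually_elim (use n0 in simp)
  ultimately have "\<forall>\<^sub>F n in sequentially.
    (\<Sum>k. pochhammer (a - 1 + of_nat (2 * n)) k * pochhammer b k * pochhammer c k /
     (pochhammer (a - b + of_nat (2 * n)) k * pochhammer (a - c + of_nat (2 * n)) k * fact k)) =
    hyp_reg (a - 1 + of_nat (2 * n)) b c (a - b + of_nat (2 * n)) (a - c + of_nat (2 * n)) /
     (rGamma (a - b + of_nat (2 * n)) * rGamma (a - c + of_nat (2 * n)))"
  proof eventually_elim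
    case (elim n)
    have p: "pochhammer z k \<noteq> 0 \<and> rGamma (z + of_nat k) = rGamma z / pochhammer z k"
      if "rGamma z \<noteq> 0" for z :: complex and k
      using that pochhammer_rGamma[of z k] by (auto simp: field_simps)
    have sm: "summable (hyp_term (a - 1 + of_nat (2 * n)) b c (a - b + of_nat (2 * n)) (a - c + of_nat (2 * n)))"
      using elim by (intro summable_hyp_term) simp
    show ?case
      unfolding hyp_reg_def suminf_divide[OF sm, symmetric] using elim
      by (simp add: hyp_term_def[abs_def] p mult_ac)
  qed
  from Lim_transform_eventually[OF tendsto_hyp_shift this] show ?thesis .
qed

text \<open>Series and product obey the same recurrence from \<open>a\<close> to
  \<open>a + 2\<close> and have the same asymptotics.\<close>

lemma dixon_reg:
  assumes s: "Re (a - 2 * b - 2 * c) > -1" and x: "(a + 1) / 2 - b - c \<notin> \<int>\<^sub>\<le>\<^sub>0"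
  shows "hyp_reg (a - 1) b c (a - b) (a - c) = dixon_prod a (a / 2) ((a + 1) / 2) b c"
proof -
  \<comment> \<open>The accumulated factor stays existential: all that matters is that series and
    product share it.\<close>
  have "\<exists>K. hyp_reg (a - 1) b c (a - b) (a - c) =
        K * hyp_reg (a - 1 + of_nat (2 * n)) b c (a - b + of_nat (2 * n)) (a - c + of_nat (2 * n)) \<and>
      dixon_prod a (a / 2) ((a + 1) / 2) b c =
        K * dixon_prod (a + of_nat (2 * n)) (a / 2 + of_nat n) ((a + 1) / 2 + of_nat n) b c" for n
  proof (induction n)
    case (Suc n)
    then obtain K where K: "hyp_reg (a - 1) b c (a - b) (a - c) =
        K * hyp_reg (a - 1 + of_nat (2 * n)) b c (a - b + of_nat (2 * n)) (a - c + of_nat (2 * n))"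
      "dixon_prod a (a / 2) ((a + 1) / 2) b c =
        K * dixon_prod (a + of_nat (2 * n)) (a / 2 + of_nat n) ((a + 1) / 2 + of_nat n) b c"
      by blast
    define w where "w = a + of_nat (2 * n)"
    have w: "a - 1 + of_nat (2 * n) = w - 1" "a - b + of_nat (2 * n) = w - b" "a - c + of_nat (2 * n) = w - c"
      "a + of_nat (2 * n) = w" "a / 2 + of_nat n = w / 2" "(a + 1) / 2 + of_nat n = (w + 1) / 2"
      by (simp_all add: w_def field_simps)
    have w': "a - 1 + of_nat (2 * Suc n) = w + 1" "a - b + of_nat (2 * Suc n) = w + 2 - b"
      "a - c + of_nat (2 * Suc n) = w + 2 - c" "a + of_nat (2 * Suc n) = w + 2"
      "a / 2 + of_nat (Suc n) = w / 2 + 1" "(a + 1) / 2 + of_nat (Suc n) = (w + 1) / 2 + 1"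
      by (simp_all add: w_def field_simps)
    have "(w + 1) / 2 - b - c = ((a + 1) / 2 - b - c) + of_nat n"
      by (simp add: w_def field_simps)
    hence xw: "(w + 1) / 2 - b - c \<notin> \<int>\<^sub>\<le>\<^sub>0"
      using x by (metis add_diff_cancel_right' nonpos_Ints_diff_Nats of_nat_in_Nats)
    hence nz: "w + 1 - 2 * b - 2 * c \<noteq> 0"
      by (auto simp: field_simps)
    have sw: "Re (w - 2 * b - 2 * c) > -1"
      using s by (simp add: w_def)
    \<comment> \<open>The composition of \<open>dixon_contiguous1\<close> at \<open>w\<close> with
      \<open>dixon_contiguous2\<close> at \<open>w + 1\<close>; the hypothesis on
      \<open>(a + 1) / 2 - b - c\<close> keeps its denominator nonzero.\<close>
    define L where "L = w * (w - b - c) * (w + 1 - 2 * b) * (w + 1 - 2 * c) * (w + 1 - b - c) /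
       (w + 1 - 2 * b - 2 * c)"
    have "(w + 1 - 2 * b - 2 * c) * (2 * hyp_reg (w + 1) b c (w + 1 - b) (w + 1 - c) -
        hyp_reg w b c (w + 1 - b) (w + 1 - c)) =
       (w + 1 - 2 * b) * (w + 1 - 2 * c) * (w + 1 - b - c) * hyp_reg (w + 1) b c (w + 2 - b) (w + 2 - c)"
      using dixon_contiguous2[of "w + 1" b c] sw by (simp add: add_ac)
    hence "hyp_reg (w - 1) b c (w - b) (w - c) = L * hyp_reg (w + 1) b c (w + 2 - b) (w + 2 - c)"
      using nz unfolding dixon_contiguous1[OF sw] by (simp add: L_def nonzero_eq_divide_eq mult_ac)
    moreover have "dixon_prod w (w / 2) ((w + 1) / 2) b c =
        L * dixon_prod (w + 2) (w / 2 + 1) ((w + 1) / 2 + 1) b c"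
    proof -
      have alg: "(z - 2 * b - 2 * c) * D = 2 * u * (z - 2 * b) * (z - 2 * c) * r * r' * D'"
        if "(v - b - c) * D = 4 * u * (v - b) * (v - c) * r * r' * D'" "2 * v = z"
        for u v z r r' D D' :: complex
        using that by algebra
      have "(w + 1 - 2 * b - 2 * c) * dixon_prod w (w / 2) ((w + 1) / 2) b c =
         2 * (w / 2) * (w + 1 - 2 * b) * (w + 1 - 2 * c) * (w - b - c) * (w + 1 - b - c) *
         dixon_prod (w + 2) (w / 2 + 1) ((w + 1) / 2 + 1) b c"
        by (rule alg[OF dixon_prod_shift2[OF xw]]) simp
      thus ?thesis using nz by (simp add: L_def nonzero_eq_divide_eq mult_ac)
    qed
    ultimately show ?case
      unfolding w' using K[unfolded w] by (intro exI[of _ "K * L"]) (simp add: mult_ac)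
  qed (auto intro!: exI[of _ 1])
  then obtain K where K: "\<And>n. hyp_reg (a - 1) b c (a - b) (a - c) =
        K n * hyp_reg (a - 1 + of_nat (2 * n)) b c (a - b + of_nat (2 * n)) (a - c + of_nat (2 * n))"
      "\<And>n. dixon_prod a (a / 2) ((a + 1) / 2) b c =
        K n * dixon_prod (a + of_nat (2 * n)) (a / 2 + of_nat n) ((a + 1) / 2 + of_nat n) b c"
    by metis
  let ?V = "hyp_reg (a - 1) b c (a - b) (a - c)" and ?G = "dixon_prod a (a / 2) ((a + 1) / 2) b c"
  let ?r = "\<lambda>n. rGamma (a - b + of_nat (2 * n)) * rGamma (a - c + of_nat (2 * n))"
  let ?S = "\<lambda>n. hyp_reg (a - 1 + of_nat (2 * n)) b c (a - b + of_nat (2 * n)) (a - c + of_nat (2 * n)) / ?r n"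
  let ?M = "\<lambda>n. dixon_prod (a + of_nat (2 * n)) (a / 2 + of_nat n) ((a + 1) / 2 + of_nat n) b c / ?r n"
  \<comment> \<open>Both sides contain \<open>K n\<close> once, so nothing is divided by it even
    where it vanishes.\<close>
  have eq: "?V * ?M n = ?G * ?S n" for n
    by (subst K(1)[of n], subst K(2)[of n]) simp
  have "(\<lambda>n. ?V * ?M n) \<longlonglongrightarrow> ?V * 1"
    by (intro tendsto_mult tendsto_const dixon_prod_asymptotics)
  moreover have "(\<lambda>n. ?V * ?M n) \<longlonglongrightarrow> ?G * 1"
    unfolding eq by (intro tendsto_mult tendsto_const hyp_reg_shift_asymptotics)
  ultimately have "?V * 1 = ?G * 1" by (rule LIMSEQ_unique)
  thus ?thesis by simp
qed

text \<open>A single use of \<open>dixon_contiguous2\<close> reduces this to Dixon's theorem at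
  \<open>a + 1\<close>. The common factor \<open>a - 2 * b - 2 * c\<close> cancels because its real
  part is positive.\<close>

lemma dixon_reg_companion:
  assumes s: "Re (a - 2 * b - 2 * c) > 0" and y: "a / 2 - b - c \<notin> \<int>\<^sub>\<le>\<^sub>0"
  shows "2 * hyp_reg a b c (a - b) (a - c) - hyp_reg (a - 1) b c (a - b) (a - c) =
    dixon_prod a ((a + 1) / 2) (a / 2) b c"
proof -
  have "(a + 1 + 1) / 2 - b - c = (a / 2 - b - c) + of_nat 1"
    by (simp add: field_simps)
  hence "(a + 1 + 1) / 2 - b - c \<notin> \<int>\<^sub>\<le>\<^sub>0"
    using y by (metis add_diff_cancel_right' nonpos_Ints_diff_Nats of_nat_in_Nats)
  hence "hyp_reg (a + 1 - 1) b c (a + 1 - b) (a + 1 - c) =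
      dixon_prod (a + 1) ((a + 1) / 2) ((a + 1 + 1) / 2) b c"
    using s by (intro dixon_reg) auto
  also have "(a + 1 + 1) / 2 = a / 2 + 1" by (simp add: field_simps)
  finally have V: "hyp_reg a b c (a + 1 - b) (a + 1 - c) = dixon_prod (a + 1) ((a + 1) / 2) (a / 2 + 1) b c"
    by simp
  have alg: "(w - 2 * b - 2 * c) * D = (w - 2 * b) * (w - 2 * c) * r * D'"
    if "(v - b - c) * D = 2 * (v - b) * (v - c) * r * D'" "2 * v = w" for v w r D D' :: complex
    using that by algebra
  have "(a - 2 * b - 2 * c) * dixon_prod a ((a + 1) / 2) (a / 2) b c =
      (a - 2 * b) * (a - 2 * c) * (a - b - c) * dixon_prod (a + 1) ((a + 1) / 2) (a / 2 + 1) b c"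
    by (rule alg[OF dixon_prod_shift1[OF y]]) simp
  also have "\<dots> = (a - 2 * b - 2 * c) * (2 * hyp_reg a b c (a - b) (a - c) - hyp_reg (a - 1) b c (a - b) (a - c))"
    using dixon_contiguous2[OF s] by (simp add: V)
  finally show ?thesis using s by (metis less_irrefl mult_left_cancel zero_complex.sel(1))
qed

section \<open>The Lucas recurrence\<close>

text \<open>Coefficients of the polynomials with the Lucas recurrence \<open>p (N + 2) = p (N + 1) + t * p N\<close> and the
  initial values \<open>p 0 = x\<close>, \<open>p 1 = 1\<close>.\<close>

fun lucas_coeff :: "nat \<Rightarrow> nat \<Rightarrow> nat \<Rightarrow> nat" where
  "lucas_coeff x 0 k = (if k = 0 then x else 0)"
| "lucas_coeff x (Suc 0) k = (if k = 0 then 1 else 0)"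
| "lucas_coeff x (Suc (Suc N)) k = lucas_coeff x (Suc N) k + (if k = 0 then 0 else lucas_coeff x N (k - 1))"

lemma lucas_coeff_eq_0: "2 * k > N \<Longrightarrow> lucas_coeff x N k = 0"
  by (induction x N k rule: lucas_coeff.induct) auto

lemma lucas_coeff_0_eq_0: "2 * k \<ge> N \<Longrightarrow> lucas_coeff 0 N k = 0"
  by (induction "0 :: nat" N k rule: lucas_coeff.induct) auto

lemma lucas_coeff_first [simp]: "lucas_coeff x (Suc N) 0 = 1"
  by (induction N) auto

text \<open>The coefficient is N/(N-k) times the binomial coefficient of N-k over k; denominators
  are cleared to stay in the natural numbers.\<close>

lemma lucas_coeff_2_fact:
  "2 * k \<le> N \<Longrightarrow> N > 0 \<Longrightarrow> lucas_coeff 2 N k * fact k * fact (N - 2 * k) = N * fact (N - 1 - k)"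
proof (induction "2 :: nat" N k rule: lucas_coeff.induct)
  case (3 N k)
  show ?case
  proof (cases k)
    case 0
    thus ?thesis by (simp add: algebra_simps)
  next
    case (Suc j)
    define i where "i = N - 2 * j"
    have N: "N = 2 * j + i" using 3 Suc by (simp add: i_def)
    \<comment> \<open>Row 0 violates the closed form (its entry is 2, the formula gives 0), so the
      induction hypothesis says nothing there.\<close>
    show ?thesis
    proof (cases "N = 0")
      case True
      thus ?thesis using Suc N by simp
    next
      case False
      have IH2: "lucas_coeff 2 N j * fact j * fact i = N * fact (N - 1 - j)"
        using 3(2) Suc N False by simp
      have IH1: "lucas_coeff 2 (Suc N) (Suc j) * fact (Suc j) * fact i = i * (N + 1) * fact (N - 1 - j)"
      proof (cases i)
        case 0
        thus ?thesis using N by (simp add: lucas_coeff_eq_0)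
      next
        case (Suc l)
        have "lucas_coeff 2 (Suc N) (Suc j) * fact (Suc j) * fact l = (N + 1) * fact (N - 1 - j)"
          using 3(1) Suc N \<open>k = Suc j\<close> by (simp del: fact_Suc)
        thus ?thesis using Suc by (simp add: algebra_simps del: fact_Suc) (simp add: algebra_simps)
      qed
      have f: "fact (N - j) = (j + i) * (fact (N - 1 - j) :: nat)"
        using N False by (cases "N - j") auto
      have "lucas_coeff 2 (Suc (Suc N)) k * fact k * fact (Suc (Suc N) - 2 * k) =
          lucas_coeff 2 (Suc N) (Suc j) * fact (Suc j) * fact i + (j + 1) * (lucas_coeff 2 N j * fact j * fact i)"
        using Suc N by (simp add: algebra_simps)
      also have "\<dots> = (i * (N + 1) + (j + 1) * N) * fact (N - 1 - j)"
        unfolding IH1 IH2 by (simp add: algebra_simps)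
      also have "i * (N + 1) + (j + 1) * N = Suc (Suc N) * (j + i)"
        using N by (simp add: algebra_simps)
      also have "\<dots> * fact (N - 1 - j) = Suc (Suc N) * fact (N - j)"
        unfolding f by (simp add: algebra_simps)
      finally show ?thesis using Suc by simp
    qed
  qed
next
  case (2 k)
  hence "k = 0" by simp
  thus ?case by simp
qed simp

text \<open>The coefficient is the binomial coefficient of N-1-k over k, again without
  division.\<close>

lemma lucas_coeff_0_fact:
  "2 * k < N \<Longrightarrow> lucas_coeff 0 N k * fact k * fact (N - 1 - 2 * k) = fact (N - 1 - k)"
proof (induction "0 :: nat" N k rule: lucas_coeff.induct)
  case (3 N k)
  show ?case
  proof (cases k)
    case (Suc j)
    define i where "i = N - 1 - 2 * j"
    have N: "N = Suc (2 * j + i)" using 3 Suc by (simp add: i_def)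
    have IH2: "lucas_coeff 0 N j * fact j * fact i = fact (j + i)"
      using 3(2) Suc N by simp
    have IH1: "lucas_coeff 0 (Suc N) (Suc j) * fact (Suc j) * fact i = i * fact (j + i)"
    proof (cases i)
      case 0
      thus ?thesis using N by (simp add: lucas_coeff_0_eq_0)
    next
      case (Suc l)
      have "lucas_coeff 0 (Suc N) (Suc j) * fact (Suc j) * fact l = fact (j + i)"
        using 3(1) Suc N \<open>k = Suc j\<close> by (simp del: fact_Suc)
      thus ?thesis using Suc by (simp add: algebra_simps del: fact_Suc) (simp add: algebra_simps)
    qed
    have "lucas_coeff 0 (Suc (Suc N)) k * fact k * fact (Suc (Suc N) - 1 - 2 * k) =
        lucas_coeff 0 (Suc N) (Suc j) * fact (Suc j) * fact i + (j + 1) * (lucas_coeff 0 N j * fact j * fact i)"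
      using Suc N by (simp add: algebra_simps)
    also have "\<dots> = (j + i + 1) * fact (j + i)"
      unfolding IH1 IH2 by (simp add: algebra_simps)
    finally show ?thesis using Suc N by simp
  qed simp
next
  case (2 k)
  hence "k = 0" by simp
  thus ?case by simp
qed simp

lemma pochhammer_minus_of_nat_fact:
  "k \<le> N \<Longrightarrow> pochhammer (- of_nat N) k * fact (N - k) = ((-1) ^ k * fact N :: complex)"
proof (induction k)
  case (Suc k)
  have "(fact (N - k) :: complex) = of_nat (N - k) * fact (N - Suc k)"
    using Suc.prems by (simp add: Suc_diff_Suc[symmetric])
  hence f: "(fact (N - k) :: complex) = (of_nat N - of_nat k) * fact (N - Suc k)"
    using Suc.prems by (simp add: of_nat_diff)
  have "pochhammer (- of_nat N) (Suc k) * fact (N - Suc k) =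
      - (pochhammer (- of_nat N) k * (fact (N - k) :: complex))"
    unfolding f pochhammer_Suc by (simp add: algebra_simps)
  thus ?case using Suc by simp
qed simp

text \<open>The cancellation shared by the next two lemmas: \<open>P\<close> is a symbol of length
  \<open>2 * k\<close> that duplication splits with \<open>e = 4 ^ k\<close>, \<open>s\<close> is
  the sign \<open>(-1) ^ k\<close>, and \<open>F\<close>, \<open>F'\<close>, \<open>f\<close> are
  factorials. The nonzero factor \<open>e * F\<close> is left for the caller to cancel.\<close>

lemma pochhammer_quotient_aux:
  fixes A :: complex
  assumes "P = e * A * B" "P * F = S * f" "p * F' = s * f" "L * K * F = S * F'" "q * e = s" "s * s = 1"
  shows "e * F * (A * B) = e * F * (q * L * (p * K))"
proof -
  have "e * F * (q * L * (p * K)) = s * p * (L * K * F)"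
    unfolding assms(5)[symmetric] by (simp only: mult_ac)
  also have "\<dots> = s * S * (p * F')" unfolding assms(4) by simp
  also have "\<dots> = (s * s) * (S * f)" unfolding assms(3) by simp
  also have "\<dots> = e * F * (A * B)" using assms(1,2,6) by (simp add: mult_ac)
  finally show ?thesis ..
qed

text \<open>By duplication the two half-step symbols merge into \<open>(-n-1)_(2k) / 4 ^ k\<close>,
  and the factorials leave the Lucas coefficient of row \<open>n + 1\<close>.\<close>

lemma lucas_coeff_2_pochhammer:
  assumes "2 * k \<le> Suc n"
  shows "pochhammer (- of_nat n / 2) k * pochhammer (- (of_nat n + 1) / 2) k =
    (-1/4) ^ k * of_nat (lucas_coeff 2 (Suc n) k) * (pochhammer (- of_nat n) k * (fact k :: complex))"
proof -
  have k: "k \<le> n" using assms by simp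
  have half: "- (of_nat n + 1) / 2 + 1 / 2 = - of_nat n / (2 :: complex)"
    by (simp add: field_simps)
  have dbl: "2 * (- (of_nat n + 1) / 2) = (- of_nat (Suc n) :: complex)"
    by simp
  have e: "(-1/4 :: complex) ^ k * 4 ^ k = (-1) ^ k" "(-1 :: complex) ^ k * (-1) ^ k = 1"
    by (simp_all flip: power_mult_distrib)
  have 1: "pochhammer (- of_nat (Suc n) :: complex) (2 * k) =
      4 ^ k * pochhammer (- of_nat n / 2) k * pochhammer (- (of_nat n + 1) / 2) k"
    using pochhammer_double[of "- (of_nat n + 1) / 2 :: complex" k] unfolding half dbl
    by (simp add: power_mult)
  have 2: "pochhammer (- of_nat (Suc n) :: complex) (2 * k) * fact (Suc n - 2 * k) = of_nat (Suc n) * fact n"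
    using pochhammer_minus_of_nat_fact[OF assms] by simp
  have 3: "pochhammer (- of_nat n :: complex) k * fact (n - k) = (-1) ^ k * fact n"
    using pochhammer_minus_of_nat_fact[OF k] .
  have 4: "of_nat (lucas_coeff 2 (Suc n) k) * fact k * fact (Suc n - 2 * k) =
      of_nat (Suc n) * (fact (n - k) :: complex)"
    using arg_cong[OF lucas_coeff_2_fact[OF assms], of "of_nat :: nat \<Rightarrow> complex"]
    by (simp del: of_nat_Suc mult_Suc)
  show ?thesis
    using pochhammer_quotient_aux[OF 1 2 3 4 e] by simp
qed

text \<open>Here the symbols merge into \<open>(-n)_(2k) / 4 ^ k\<close>, one unit lower, which
  produces the Fibonacci coefficient instead.\<close>

lemma lucas_coeff_0_pochhammer:
  assumes "2 * k \<le> n"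
  shows "pochhammer (- (of_nat n - 1) / 2) k * pochhammer (- of_nat n / 2) k =
    (-1/4) ^ k * of_nat (lucas_coeff 0 (Suc n) k) * (pochhammer (- of_nat n) k * (fact k :: complex))"
proof -
  have k: "k \<le> n" using assms by simp
  have half: "- of_nat n / 2 + 1 / 2 = - (of_nat n - 1) / (2 :: complex)"
    by (simp add: field_simps)
  have e: "(-1/4 :: complex) ^ k * 4 ^ k = (-1) ^ k" "(-1 :: complex) ^ k * (-1) ^ k = 1"
    by (simp_all flip: power_mult_distrib)
  have 1: "pochhammer (- of_nat n :: complex) (2 * k) =
      4 ^ k * pochhammer (- (of_nat n - 1) / 2) k * pochhammer (- of_nat n / 2) k"
    using pochhammer_double[of "- of_nat n / 2 :: complex" k] unfolding half
    by (simp add: power_mult)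
  have 2: "pochhammer (- of_nat n :: complex) (2 * k) * fact (n - 2 * k) = 1 * fact n"
    using pochhammer_minus_of_nat_fact[OF assms] by simp
  have 3: "pochhammer (- of_nat n :: complex) k * fact (n - k) = (-1) ^ k * fact n"
    using pochhammer_minus_of_nat_fact[OF k] .
  have 4: "of_nat (lucas_coeff 0 (Suc n) k) * fact k * fact (n - 2 * k) = 1 * (fact (n - k) :: complex)"
    using arg_cong[OF lucas_coeff_0_fact[of k "Suc n"], of "of_nat :: nat \<Rightarrow> complex"] assms by simp
  show ?thesis
    using pochhammer_quotient_aux[OF 1 2 3 4 e] by simp
qed

lemma lucas_sum_rec:
  fixes h :: "nat \<Rightarrow> complex"
  shows "(\<Sum>k\<le>Suc (Suc N). of_nat (lucas_coeff x (Suc (Suc N)) k) * h k) =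
    (\<Sum>k\<le>Suc N. of_nat (lucas_coeff x (Suc N) k) * h k) + (\<Sum>k\<le>N. of_nat (lucas_coeff x N k) * h (Suc k))"
proof -
  have "(\<Sum>k\<le>Suc (Suc N). of_nat (lucas_coeff x (Suc (Suc N)) k) * h k) =
    (\<Sum>k\<le>Suc (Suc N). of_nat (lucas_coeff x (Suc N) k) * h k) +
    (\<Sum>k\<le>Suc (Suc N). of_nat (if k = 0 then 0 else lucas_coeff x N (k - 1)) * h k)"
    by (simp only: lucas_coeff.simps of_nat_add distrib_right sum.distrib)
  also have "(\<Sum>k\<le>Suc (Suc N). of_nat (lucas_coeff x (Suc N) k) * h k) =
      (\<Sum>k\<le>Suc N. of_nat (lucas_coeff x (Suc N) k) * h k)"
    by (subst sum.atMost_Suc) (simp add: lucas_coeff_eq_0 del: sum.atMost_Suc)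
  also have "(\<Sum>k\<le>Suc (Suc N). of_nat (if k = 0 then 0 else lucas_coeff x N (k - 1)) * h k) =
      (\<Sum>k\<le>Suc N. of_nat (lucas_coeff x N k) * h (Suc k))"
    by (subst sum.atMost_Suc_shift) (simp del: sum.atMost_Suc)
  also have "\<dots> = (\<Sum>k\<le>N. of_nat (lucas_coeff x N k) * h (Suc k))"
    by (simp add: lucas_coeff_eq_0)
  finally show ?thesis .
qed

section \<open>Parameter shifts of the Dixon products and solution of the recurrence\<close>

lemma not_nonpos_Ints_add_of_nat:
  "z \<notin> \<int>\<^sub>\<le>\<^sub>0 \<Longrightarrow> z + of_nat n \<notin> \<int>\<^sub>\<le>\<^sub>0" for z :: complex
  by (metis add_diff_cancel_right' nonpos_Ints_diff_Nats of_nat_in_Nats)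

text \<open>Turns a denominator condition of a 4F3 into one on Gamma arguments, with
  \<open>z = v - b - c\<close>: it excludes z = 1, ..., k, the only values for which a subtraction
  of at most k could reach a pole.\<close>

lemma not_nonpos_Ints_diff_of_nat:
  fixes z :: complex
  assumes "z \<notin> \<int>\<^sub>\<le>\<^sub>0" "pochhammer (1 - z) k \<noteq> 0" "j \<le> k"
  shows "z - of_nat j \<notin> \<int>\<^sub>\<le>\<^sub>0"
proof
  assume "z - of_nat j \<in> \<int>\<^sub>\<le>\<^sub>0"
  then obtain i where "z - of_nat j = - of_nat i" by (elim nonpos_Ints_cases')
  hence z: "z = of_nat j - of_nat i" by (simp add: algebra_simps)
  have "i < j"
  proof (rule ccontr)
    assume "\<not> i < j"
    hence "z = - of_nat (i - j)" by (simp add: z of_nat_diff)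
    thus False using assms(1) by (metis minus_of_nat_in_nonpos_Ints)
  qed
  hence "1 - z = - of_nat (j - i - 1)" by (simp add: z of_nat_diff)
  moreover have "j - i - 1 < k" using \<open>i < j\<close> assms(3) by simp
  ultimately have "pochhammer (1 - z) k = 0"
    unfolding pochhammer_eq_0_iff by blast
  thus False using assms(2) by contradiction
qed

text \<open>Each step changes only the power of 2, \<open>rGamma u\<close> and
  \<open>Gamma (v - b - c)\<close>. The argument of the last drops by one, so the lowered arguments
  must avoid the poles.\<close>

lemma dixon_prod_shift:
  assumes "\<And>j. 0 < j \<Longrightarrow> j \<le> k \<Longrightarrow> v - b - c - of_nat j \<notin> \<int>\<^sub>\<le>\<^sub>0"
  shows "dixon_prod a u v b c = (-4) ^ k * pochhammer u k * pochhammer (1 - v + b + c) k *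
    dixon_prod (a + 2 * of_nat k) (u + of_nat k) (v + of_nat k) (b + of_nat k) (c + of_nat k)"
  using assms
proof (induction k)
  case (Suc k)
  let ?a = "a + 2 * of_nat k" and ?u = "u + of_nat k" and ?v = "v + of_nat k"
    and ?b = "b + of_nat k" and ?c = "c + of_nat k"
  have v: "?v - ?b - ?c - 1 \<notin> \<int>\<^sub>\<le>\<^sub>0"
    using Suc.prems[of "Suc k"] by (simp add: algebra_simps)
  have G: "Gamma (?v - ?b - ?c) = (?v - ?b - ?c - 1) * Gamma (?v - ?b - ?c - 1)"
    using Gamma_plus1[OF v] by simp
  have R: "rGamma ?u = ?u * rGamma (?u + 1)"
    by (rule rGamma_plus1[symmetric])
  have "dixon_prod ?a ?u ?v ?b ?c =
      4 * ?u * (?v - ?b - ?c - 1) * dixon_prod (?a + 2) (?u + 1) (?v + 1) (?b + 1) (?c + 1)"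
    unfolding dixon_prod_def exp_ln2_step G R by (simp add: algebra_simps)
  also have "4 * ?u * (?v - ?b - ?c - 1) = (-4) * ?u * (1 - v + b + c + of_nat k)"
    by (simp add: algebra_simps)
  finally have step: "dixon_prod ?a ?u ?v ?b ?c = (-4) * ?u * (1 - v + b + c + of_nat k) *
      dixon_prod (a + 2 * of_nat (Suc k)) (u + of_nat (Suc k)) (v + of_nat (Suc k)) (b + of_nat (Suc k)) (c + of_nat (Suc k))"
    by (simp add: add_ac)
  have "dixon_prod a u v b c = (-4) ^ k * pochhammer u k * pochhammer (1 - v + b + c) k * dixon_prod ?a ?u ?v ?b ?c"
    using Suc by simp
  thus ?case
    unfolding step pochhammer_Suc power_Suc by (simp only: mult_ac)
qed simp

text \<open>What multiplies the \<open>k\<close>-th polynomial coefficient: the factors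
  \<open>b * c\<close> of \<open>k\<close> two-step branches accumulate to the two Pochhammer
  symbols.\<close>

definition dixon_up :: "complex \<Rightarrow> complex \<Rightarrow> complex \<Rightarrow> complex \<Rightarrow> complex \<Rightarrow> nat \<Rightarrow> complex" where
  "dixon_up a u v b c k = pochhammer b k * pochhammer c k *
     dixon_prod (a + 2 * of_nat k) (u + of_nat k) (v + of_nat k) (b + of_nat k) (c + of_nat k)"

text \<open>The counterpart for the recurrence solved backwards; each step divides by
  \<open>(b - 1) * (c - 1)\<close> at the current parameters, and the signs cancel in pairs.\<close>

definition dixon_down :: "complex \<Rightarrow> complex \<Rightarrow> complex \<Rightarrow> complex \<Rightarrow> complex \<Rightarrow> nat \<Rightarrow> complex" where
  "dixon_down a u v b c j =
     dixon_prod (a - 2 * of_nat j) (u - of_nat j) (v - of_nat j) (b - of_nat j) (c - of_nat j) /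
     (pochhammer (1 - b) j * pochhammer (1 - c) j)"

lemma dixon_up_Suc:
  "dixon_up a u v b c (Suc k) = b * c * dixon_up (a + 2) (u + 1) (v + 1) (b + 1) (c + 1) k"
  by (simp add: dixon_up_def pochhammer_rec add_ac)

lemma dixon_down_Suc:
  "dixon_down a u v b c (Suc k) =
     dixon_down (a - 2) (u - 1) (v - 1) (b - 1) (c - 1) k / ((1 - b) * (1 - c))"
  by (simp add: dixon_down_def pochhammer_rec algebra_simps)

text \<open>Here \<open>N\<close> stands for \<open>n + 1\<close>, so rows 0 and 1 are the indices
  -1 and 0. Fibonacci coefficients vanish from \<open>2 * k = N\<close> on, whence the strict bound
  in the last assumption.\<close>

lemma hyp_reg_up:
  assumes "Re (a - 2 * b - 2 * c - of_nat N) > -1"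
    and "\<And>k. 2 * k \<le> N \<Longrightarrow> (a + 1) / 2 - b - c - of_nat k \<notin> \<int>\<^sub>\<le>\<^sub>0"
    and "\<And>k. 2 * k < N \<Longrightarrow> a / 2 - b - c - of_nat k \<notin> \<int>\<^sub>\<le>\<^sub>0"
  shows "2 * hyp_reg (a + of_nat N - 1) b c (a - b) (a - c) =
    (\<Sum>k\<le>N. of_nat (lucas_coeff 2 N k) * dixon_up a (a / 2) ((a + 1) / 2) b c k) +
    (\<Sum>k\<le>N. of_nat (lucas_coeff 0 N k) * dixon_up a ((a + 1) / 2) (a / 2) b c k)"
  using assms
proof (induction N arbitrary: a b c rule: induct_nat_012)
  case 0
  thus ?case using dixon_reg[of a b c] 0(2)[of 0] by (simp add: dixon_up_def)
next
  case 1
  have "hyp_reg (a - 1) b c (a - b) (a - c) = dixon_prod a (a / 2) ((a + 1) / 2) b c"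
    using 1(1) 1(2)[of 0] by (intro dixon_reg) auto
  moreover have "2 * hyp_reg a b c (a - b) (a - c) - hyp_reg (a - 1) b c (a - b) (a - c) =
    dixon_prod a ((a + 1) / 2) (a / 2) b c"
    using 1(1) 1(3)[of 0] by (intro dixon_reg_companion) auto
  ultimately show ?case by (simp add: dixon_up_def algebra_simps)
next
  case (ge2 N)
  let ?P = "\<lambda>N a b c. \<Sum>k\<le>N. of_nat (lucas_coeff 2 N k) * dixon_up a (a / 2) ((a + 1) / 2) b c k"
  let ?Q = "\<lambda>N a b c. \<Sum>k\<le>N. of_nat (lucas_coeff 0 N k) * dixon_up a ((a + 1) / 2) (a / 2) b c k"
  have half: "(a + 2) / 2 = a / 2 + 1" "(a + 2 + 1) / 2 = (a + 1) / 2 + 1"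
    by (simp_all add: field_simps)
  have IH1: "2 * hyp_reg (a + of_nat (Suc N) - 1) b c (a - b) (a - c) = ?P (Suc N) a b c + ?Q (Suc N) a b c"
  proof (rule ge2.IH(2))
    show "Re (a - 2 * b - 2 * c - of_nat (Suc N)) > -1" using ge2.prems(1) by simp
  qed (use ge2.prems(2,3) in auto)
  have IH2: "2 * hyp_reg (a + 2 + of_nat N - 1) (b + 1) (c + 1) (a + 2 - (b + 1)) (a + 2 - (c + 1)) =
      ?P N (a + 2) (b + 1) (c + 1) + ?Q N (a + 2) (b + 1) (c + 1)"
  proof (rule ge2.IH(1))
    show "Re (a + 2 - 2 * (b + 1) - 2 * (c + 1) - of_nat N) > -1" using ge2.prems(1) by simp
  next
    fix k assume "2 * k \<le> N"
    thus "(a + 2 + 1) / 2 - (b + 1) - (c + 1) - of_nat k \<notin> \<int>\<^sub>\<le>\<^sub>0"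
      unfolding half using ge2.prems(2)[of "Suc k"] by (simp add: algebra_simps)
  next
    fix k assume "2 * k < N"
    thus "(a + 2) / 2 - (b + 1) - (c + 1) - of_nat k \<notin> \<int>\<^sub>\<le>\<^sub>0"
      unfolding half using ge2.prems(3)[of "Suc k"] by (simp add: algebra_simps)
  qed
  have P: "?P (Suc (Suc N)) a b c = ?P (Suc N) a b c + b * c * ?P N (a + 2) (b + 1) (c + 1)"
    unfolding lucas_sum_rec dixon_up_Suc half by (simp add: sum_distrib_left mult_ac)
  have Q: "?Q (Suc (Suc N)) a b c = ?Q (Suc N) a b c + b * c * ?Q N (a + 2) (b + 1) (c + 1)"
    unfolding lucas_sum_rec dixon_up_Suc half by (simp add: sum_distrib_left mult_ac)
  have "hyp_reg (a + of_nat (Suc (Suc N)) - 1) b c (a - b) (a - c) =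
      hyp_reg (a + of_nat (Suc N) - 1) b c (a - b) (a - c) +
      b * c * hyp_reg (a + 2 + of_nat N - 1) (b + 1) (c + 1) (a + 2 - (b + 1)) (a + 2 - (c + 1))"
    using ge2.prems(1) by (subst hyp_reg_contiguous) (simp_all add: algebra_simps)
  thus ?case unfolding P Q using IH1 IH2 by (simp add: algebra_simps)
qed

text \<open>Solved backwards, \<open>(1 - b) * (1 - c) * F (-m-1)\<close> at
  \<open>(a, b, c)\<close> is \<open>F (1-m) - F (-m)\<close> at
  \<open>(a - 2, b - 1, c - 1)\<close>. Without the sign \<open>(-1) ^ m\<close> the sequence starts
  with \<open>2 * D\<close>, \<open>D - C\<close> at suitably shifted parameters: Lucas in
  \<open>D\<close>, minus Fibonacci in \<open>C\<close>. Both terms sit at the shifted point, so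
  \<open>k\<close> two-step branches go with \<open>m - k\<close> shifts.\<close>

lemma hyp_reg_down:
  assumes "Re (a - 2 * b - 2 * c + of_nat m) > -1"
    and "(a + 1) / 2 - b - c \<notin> \<int>\<^sub>\<le>\<^sub>0" and "a / 2 - b - c \<notin> \<int>\<^sub>\<le>\<^sub>0"
    and "pochhammer (1 - b) m \<noteq> 0" and "pochhammer (1 - c) m \<noteq> 0"
  shows "2 * hyp_reg (a - of_nat m - 1) b c (a - b) (a - c) = (-1) ^ m *
    ((\<Sum>k\<le>m. of_nat (lucas_coeff 2 m k) * dixon_down a (a / 2) ((a + 1) / 2) b c (m - k)) -
    (\<Sum>k\<le>m. of_nat (lucas_coeff 0 m k) * dixon_down a ((a + 1) / 2) (a / 2) b c (m - k)))"
  using assms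
proof (induction m arbitrary: a b c rule: induct_nat_012)
  case 0
  thus ?case using dixon_reg[of a b c] by (simp add: dixon_down_def)
next
  case 1
  have half: "(a - 2) / 2 = a / 2 - 1" "(a - 2 + 1) / 2 = (a + 1) / 2 - 1"
    by (simp_all add: field_simps)
  have alg: "2 * ((1 - b) * (1 - c) * X) = D' - D"
    if "V = D" "2 * U - V = D'" "U = V + (b - 1) * (c - 1) * X" for X U V D D' :: complex
    unfolding that(1)[symmetric] that(2)[symmetric] that(3) by (simp add: algebra_simps)
  have sub: "a - 2 - (b - 1) = a - b - 1" "a - 2 - (c - 1) = a - c - 1" by simp_all
  have xy: "(a - 2 + 1) / 2 - (b - 1) - (c - 1) \<notin> \<int>\<^sub>\<le>\<^sub>0" "(a - 2) / 2 - (b - 1) - (c - 1) \<notin> \<int>\<^sub>\<le>\<^sub>0"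
    unfolding half using not_nonpos_Ints_add_of_nat[OF 1(2), of 1] not_nonpos_Ints_add_of_nat[OF 1(3), of 1]
    by (simp_all add: algebra_simps)
  have "hyp_reg (a - 2 - 1) (b - 1) (c - 1) (a - 2 - (b - 1)) (a - 2 - (c - 1)) =
      dixon_prod (a - 2) ((a - 2) / 2) ((a - 2 + 1) / 2) (b - 1) (c - 1)"
    by (rule dixon_reg[OF _ xy(1)]) (use 1(1) in simp)
  moreover have "2 * hyp_reg (a - 2) (b - 1) (c - 1) (a - 2 - (b - 1)) (a - 2 - (c - 1)) -
      hyp_reg (a - 2 - 1) (b - 1) (c - 1) (a - 2 - (b - 1)) (a - 2 - (c - 1)) =
      dixon_prod (a - 2) ((a - 2 + 1) / 2) ((a - 2) / 2) (b - 1) (c - 1)"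
    by (rule dixon_reg_companion[OF _ xy(2)]) (use 1(1) in simp)
  moreover have "hyp_reg (a - 2) (b - 1) (c - 1) (a - b - 1) (a - c - 1) =
      hyp_reg (a - 2 - 1) (b - 1) (c - 1) (a - b - 1) (a - c - 1) +
      (b - 1) * (c - 1) * hyp_reg (a - 2) b c (a - b) (a - c)"
    using 1(1) by (subst hyp_reg_contiguous) simp_all
  ultimately have eq: "2 * ((1 - b) * (1 - c) * hyp_reg (a - 2) b c (a - b) (a - c)) =
      dixon_prod (a - 2) ((a + 1) / 2 - 1) (a / 2 - 1) (b - 1) (c - 1) -
      dixon_prod (a - 2) (a / 2 - 1) ((a + 1) / 2 - 1) (b - 1) (c - 1)"
    unfolding sub half by (rule alg)
  have "(1 - b) * (1 - c) \<noteq> 0" using 1(4,5) by auto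
  hence "2 * hyp_reg (a - 2) b c (a - b) (a - c) =
      (dixon_prod (a - 2) ((a + 1) / 2 - 1) (a / 2 - 1) (b - 1) (c - 1) -
      dixon_prod (a - 2) (a / 2 - 1) ((a + 1) / 2 - 1) (b - 1) (c - 1)) / ((1 - b) * (1 - c))"
    using eq by (simp add: nonzero_eq_divide_eq mult_ac)
  thus ?case by (simp add: dixon_down_def diff_divide_distrib)
next
  case (ge2 m)
  let ?P = "\<lambda>m a b c. \<Sum>k\<le>m. of_nat (lucas_coeff 2 m k) * dixon_down a (a / 2) ((a + 1) / 2) b c (m - k)"
  let ?Q = "\<lambda>m a b c. \<Sum>k\<le>m. of_nat (lucas_coeff 0 m k) * dixon_down a ((a + 1) / 2) (a / 2) b c (m - k)"
  let ?D = "(1 - b) * (1 - c)"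
  have half: "(a - 2) / 2 = a / 2 - 1" "(a - 2 + 1) / 2 = (a + 1) / 2 - 1"
    by (simp_all add: field_simps)
  have sub: "a - 2 - (b - 1) = a - b - 1" "a - 2 - (c - 1) = a - c - 1" by simp_all
  have alg: "e * (p - q) - (-1 * e) * (P - Q) = e * ((P + p) - (Q + q))" for e p q P Q :: complex
    by (simp add: algebra_simps)
  have "1 - (z - 1) = 1 - z + 1" for z :: complex by simp
  hence poch: "1 - z \<noteq> 0" "pochhammer (1 - (z - 1)) (Suc m) \<noteq> 0" "pochhammer (1 - (z - 1)) m \<noteq> 0"
    if "pochhammer (1 - z) (Suc (Suc m)) \<noteq> 0" for z :: complex
    using that pochhammer_rec[of "1 - z" "Suc m"] pochhammer_neq_0_mono[of "1 - z + 1" "Suc m" m] by auto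
  note poch_b = poch[OF ge2.prems(4)] and poch_c = poch[OF ge2.prems(5)]
  have xy: "(a - 2 + 1) / 2 - (b - 1) - (c - 1) \<notin> \<int>\<^sub>\<le>\<^sub>0" "(a - 2) / 2 - (b - 1) - (c - 1) \<notin> \<int>\<^sub>\<le>\<^sub>0"
    unfolding half using not_nonpos_Ints_add_of_nat[OF ge2.prems(2), of 1]
      not_nonpos_Ints_add_of_nat[OF ge2.prems(3), of 1]
    by (simp_all add: algebra_simps)
  have IH1: "2 * hyp_reg (a - 2 - of_nat (Suc m) - 1) (b - 1) (c - 1) (a - 2 - (b - 1)) (a - 2 - (c - 1)) =
      (-1) ^ Suc m * (?P (Suc m) (a - 2) (b - 1) (c - 1) - ?Q (Suc m) (a - 2) (b - 1) (c - 1))"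
    using ge2.prems(1) by (intro ge2.IH(2) xy poch_b poch_c) simp
  have IH2: "2 * hyp_reg (a - 2 - of_nat m - 1) (b - 1) (c - 1) (a - 2 - (b - 1)) (a - 2 - (c - 1)) =
      (-1) ^ m * (?P m (a - 2) (b - 1) (c - 1) - ?Q m (a - 2) (b - 1) (c - 1))"
    using ge2.prems(1) by (intro ge2.IH(1) xy poch_b poch_c) simp
  have split: "(\<Sum>k\<le>Suc (Suc m). of_nat (lucas_coeff x (Suc (Suc m)) k) * dixon_down a u v b c (Suc (Suc m) - k)) =
      ((\<Sum>k\<le>Suc m. of_nat (lucas_coeff x (Suc m) k) *
          dixon_down (a - 2) (u - 1) (v - 1) (b - 1) (c - 1) (Suc m - k)) +
       (\<Sum>k\<le>m. of_nat (lucas_coeff x m k) *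
          dixon_down (a - 2) (u - 1) (v - 1) (b - 1) (c - 1) (m - k))) / ?D" for x u v
  proof -
    have "(\<Sum>k\<le>Suc m. of_nat (lucas_coeff x (Suc m) k) * dixon_down a u v b c (Suc (Suc m) - k)) =
        (\<Sum>k\<le>Suc m. of_nat (lucas_coeff x (Suc m) k) *
          dixon_down (a - 2) (u - 1) (v - 1) (b - 1) (c - 1) (Suc m - k)) / ?D"
      unfolding sum_divide_distrib
      by (intro sum.cong) (auto simp: Suc_diff_le dixon_down_Suc)
    moreover have "(\<Sum>k\<le>m. of_nat (lucas_coeff x m k) * dixon_down a u v b c (Suc (Suc m) - Suc k)) =
        (\<Sum>k\<le>m. of_nat (lucas_coeff x m k) *
          dixon_down (a - 2) (u - 1) (v - 1) (b - 1) (c - 1) (m - k)) / ?D"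
      unfolding sum_divide_distrib
      by (intro sum.cong) (auto simp: Suc_diff_le dixon_down_Suc)
    ultimately show ?thesis
      unfolding lucas_sum_rec by (simp add: add_divide_distrib)
  qed
  have P: "?P (Suc (Suc m)) a b c = (?P (Suc m) (a - 2) (b - 1) (c - 1) + ?P m (a - 2) (b - 1) (c - 1)) / ?D"
    unfolding half by (rule split)
  have Q: "?Q (Suc (Suc m)) a b c = (?Q (Suc m) (a - 2) (b - 1) (c - 1) + ?Q m (a - 2) (b - 1) (c - 1)) / ?D"
    unfolding half by (rule split)
  have "hyp_reg (a - 2 - of_nat m - 1) (b - 1) (c - 1) (a - 2 - (b - 1)) (a - 2 - (c - 1)) =
      hyp_reg (a - 2 - of_nat (Suc m) - 1) (b - 1) (c - 1) (a - 2 - (b - 1)) (a - 2 - (c - 1)) +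
      ?D * hyp_reg (a - of_nat (Suc (Suc m)) - 1) b c (a - b) (a - c)"
    unfolding sub using ge2.prems(1) by (subst hyp_reg_contiguous) (simp_all add: algebra_simps)
  hence "?D * (2 * hyp_reg (a - of_nat (Suc (Suc m)) - 1) b c (a - b) (a - c)) =
      2 * hyp_reg (a - 2 - of_nat m - 1) (b - 1) (c - 1) (a - 2 - (b - 1)) (a - 2 - (c - 1)) -
      2 * hyp_reg (a - 2 - of_nat (Suc m) - 1) (b - 1) (c - 1) (a - 2 - (b - 1)) (a - 2 - (c - 1))"
    by simp
  also have "\<dots> = (-1) ^ m * ((?P (Suc m) (a - 2) (b - 1) (c - 1) + ?P m (a - 2) (b - 1) (c - 1)) -
      (?Q (Suc m) (a - 2) (b - 1) (c - 1) + ?Q m (a - 2) (b - 1) (c - 1)))"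
    unfolding IH1 IH2 power_Suc by (rule alg)
  also have "\<dots> = ?D * ((-1) ^ Suc (Suc m) * (?P (Suc (Suc m)) a b c - ?Q (Suc (Suc m)) a b c))"
    unfolding P Q using poch_b(1) poch_c(1) by (simp add: diff_divide_distrib[symmetric])
  finally show ?case using poch_b(1) poch_c(1) by simp
qed

section \<open>Identification with the 4F3 sums\<close>

lemma hyp3F2_eq_hyp_reg:
  assumes "E \<notin> \<int>\<^sub>\<le>\<^sub>0" "F \<notin> \<int>\<^sub>\<le>\<^sub>0" "Re (E + F - A - B - C) > 0"
  shows "hyp3F2 A B C E F = Gamma E * Gamma F * hyp_reg A B C E F"
proof -
  have p: "Gamma z * rGamma (z + of_nat k) = 1 / pochhammer z k" if "z \<notin> \<int>\<^sub>\<le>\<^sub>0" for z :: complex and k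
    using that pochhammer_rGamma[of z k] rGamma_nonzero[OF that] by (simp add: Gamma_def field_simps)
  have t: "Gamma E * Gamma F * hyp_term A B C E F k =
      pochhammer A k * pochhammer B k * pochhammer C k / (pochhammer E k * pochhammer F k * fact k)" for k
  proof -
    have "Gamma E * Gamma F * hyp_term A B C E F k = pochhammer A k * pochhammer B k * pochhammer C k / fact k *
        ((Gamma E * rGamma (E + of_nat k)) * (Gamma F * rGamma (F + of_nat k)))"
      by (simp add: hyp_term_def)
    thus ?thesis unfolding p[OF assms(1)] p[OF assms(2)] by (simp add: mult_ac)
  qed
  have "Gamma E * Gamma F * hyp_reg A B C E F = (\<Sum>k. Gamma E * Gamma F * hyp_term A B C E F k)"
    unfolding hyp_reg_def using assms(3) by (intro suminf_mult[symmetric] summable_hyp_term)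
  also have "\<dots> = hyp3F2 A B C E F"
    unfolding hyp3F2_def t ..
  finally show ?thesis ..
qed

text \<open>The factor \<open>(-4) ^ k\<close> of \<open>dixon_prod_shift\<close> cancels the
  \<open>(-1/4) ^ k\<close> of the coefficient formula. Coefficients and parameters are kept
  abstract to serve both products.\<close>

lemma sum_dixon_up:
  assumes L: "\<And>k. k \<le> K \<Longrightarrow> pochhammer \<alpha> k * pochhammer \<beta> k = (-1/4) ^ k * of_nat (L k) * (pochhammer \<gamma> k * fact k)"
    and L0: "\<And>k. k > K \<Longrightarrow> L k = 0" and "K \<le> N"
    and z: "v - b - c \<notin> \<int>\<^sub>\<le>\<^sub>0" and w: "w = 1 - v + b + c"
    and ok: "hyp4F3_upto_ok K \<gamma> u w"
  shows "(\<Sum>k\<le>N. of_nat (L k) * dixon_up a u v b c k) =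
    hyp4F3_upto K \<alpha> \<beta> b c \<gamma> u w * dixon_prod a u v b c"
proof -
  have "(\<Sum>k\<le>N. of_nat (L k) * dixon_up a u v b c k) = (\<Sum>k\<le>K. of_nat (L k) * dixon_up a u v b c k)"
    using \<open>K \<le> N\<close> L0 by (intro sum.mono_neutral_right) auto
  also have "\<dots> = (\<Sum>k\<le>K. pochhammer \<alpha> k * pochhammer \<beta> k * pochhammer b k * pochhammer c k /
      (pochhammer \<gamma> k * pochhammer u k * pochhammer w k * fact k) * dixon_prod a u v b c)"
  proof (intro sum.cong refl)
    fix k assume "k \<in> {..K}"
    hence k: "k \<le> K" by simp
    have nz: "pochhammer \<gamma> k \<noteq> 0" "pochhammer u k \<noteq> 0" "pochhammer w k \<noteq> 0"
      using ok k by (auto simp: hyp4F3_upto_ok_def)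
    have "1 - (v - b - c) = w" by (simp add: w)
    hence "v - b - c - of_nat j \<notin> \<int>\<^sub>\<le>\<^sub>0" if "j \<le> k" for j
      using not_nonpos_Ints_diff_of_nat[OF z _ that] nz by simp
    hence D: "dixon_prod a u v b c = (-4) ^ k * pochhammer u k * pochhammer w k *
        dixon_prod (a + 2 * of_nat k) (u + of_nat k) (v + of_nat k) (b + of_nat k) (c + of_nat k)"
      unfolding w by (intro dixon_prod_shift) auto
    have e: "(-1/4 :: complex) ^ k * (-4) ^ k = 1"
      by (simp flip: power_mult_distrib)
    have "pochhammer \<alpha> k * pochhammer \<beta> k * pochhammer b k * pochhammer c k /
        (pochhammer \<gamma> k * pochhammer u k * pochhammer w k * fact k) * dixon_prod a u v b c =
        ((-1/4) ^ k * (-4) ^ k) * (of_nat (L k) * dixon_up a u v b c k)"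
      unfolding L[OF k] D dixon_up_def using nz by (simp add: field_simps)
    thus "of_nat (L k) * dixon_up a u v b c k = pochhammer \<alpha> k * pochhammer \<beta> k * pochhammer b k * pochhammer c k /
        (pochhammer \<gamma> k * pochhammer u k * pochhammer w k * fact k) * dixon_prod a u v b c"
      unfolding e by simp
  qed
  also have "\<dots> = hyp4F3_upto K \<alpha> \<beta> b c \<gamma> u w * dixon_prod a u v b c"
    by (simp add: hyp4F3_upto_def sum_distrib_right)
  finally show ?thesis .
qed

lemma pochhammer_reflect: "pochhammer (1 - z) m = (-1) ^ m * pochhammer (z - of_nat m) m" for z :: complex
  using pochhammer_minus[of "z - 1" m] by (simp add: algebra_simps)

text \<open>Splits the prefactors at negative index: the first \<open>k\<close> factors cancel
  against the 4F3 term, the other \<open>m - k\<close> belong to the shift of the Dixon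
  product.\<close>

lemma pochhammer_split_below:
  "k \<le> m \<Longrightarrow> pochhammer (z - of_nat m) m = pochhammer (z - of_nat m) k * pochhammer (z - of_nat (m - k)) (m - k)"
  for z :: complex
  using pochhammer_product[of k m "z - of_nat m"] by (simp add: of_nat_diff algebra_simps)

lemma sum_dixon_down:
  assumes L: "\<And>k. k \<le> K \<Longrightarrow> pochhammer \<alpha> k * pochhammer \<beta> k = (-1/4) ^ k * of_nat (L k) * (pochhammer \<gamma> k * fact k)"
    and L0: "\<And>k. k > K \<Longrightarrow> L k = 0" and "K \<le> m"
    and z: "v - b - c \<notin> \<int>\<^sub>\<le>\<^sub>0" and w: "w = 1 - v + b + c - of_nat m"
    and ok: "hyp4F3_upto_ok K \<gamma> (u - of_nat m) w"
    and bc: "pochhammer (1 - b) m * pochhammer (1 - c) m \<noteq> 0"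
  shows "(-1) ^ m * (\<Sum>k\<le>m. of_nat (L k) * dixon_down a u v b c (m - k)) =
    2 ^ (2 * m) * ((pochhammer (1 - u) m * pochhammer (v - b - c) m) /
      (pochhammer (1 - b) m * pochhammer (1 - c) m)) *
    hyp4F3_upto K \<alpha> \<beta> (b - of_nat m) (c - of_nat m) \<gamma> (u - of_nat m) w * dixon_prod a u v b c"
proof -
  have "(\<Sum>k\<le>m. of_nat (L k) * dixon_down a u v b c (m - k)) =
      (\<Sum>k\<le>K. of_nat (L k) * dixon_down a u v b c (m - k))"
    using \<open>K \<le> m\<close> L0 by (intro sum.mono_neutral_right) auto
  hence "(-1) ^ m * (\<Sum>k\<le>m. of_nat (L k) * dixon_down a u v b c (m - k)) =
      (\<Sum>k\<le>K. (-1) ^ m * (of_nat (L k) * dixon_down a u v b c (m - k)))"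
    by (simp add: sum_distrib_left)
  also have "\<dots> = (\<Sum>k\<le>K. 2 ^ (2 * m) * ((pochhammer (1 - u) m * pochhammer (v - b - c) m) /
      (pochhammer (1 - b) m * pochhammer (1 - c) m)) *
      (pochhammer \<alpha> k * pochhammer \<beta> k * pochhammer (b - of_nat m) k * pochhammer (c - of_nat m) k /
      (pochhammer \<gamma> k * pochhammer (u - of_nat m) k * pochhammer w k * fact k)) * dixon_prod a u v b c)"
  proof (intro sum.cong refl)
    fix k assume "k \<in> {..K}"
    hence k: "k \<le> K" "k \<le> m" using \<open>K \<le> m\<close> by simp_all
    define j where "j = m - k"
    define x where "x = 1 - v + b + c"
    have m: "m = k + j" using k by (simp add: j_def)
    have nz: "pochhammer \<gamma> k \<noteq> 0" "pochhammer (u - of_nat m) k \<noteq> 0" "pochhammer (x - of_nat m) k \<noteq> 0"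
      using ok k by (auto simp: hyp4F3_upto_ok_def w x_def)
    have s: "pochhammer (1 - y) m = (-1) ^ m * (pochhammer (y - of_nat m) k * pochhammer (y - of_nat j) j)" for y :: complex
      unfolding pochhammer_reflect j_def pochhammer_split_below[OF k(2), symmetric] ..
    have X: "pochhammer (v - b - c) m = pochhammer (1 - x) m"
      by (rule arg_cong[of _ _ "\<lambda>y. pochhammer y m"]) (simp add: x_def)
    have "v - of_nat j - (b - of_nat j) - (c - of_nat j) - of_nat i \<notin> \<int>\<^sub>\<le>\<^sub>0" if "i \<le> j" for i
      using not_nonpos_Ints_add_of_nat[OF z, of "j - i"] that by (simp add: of_nat_diff algebra_simps)
    \<comment> \<open>The shift lemma starts at the lowered parameters and climbs \<open>j\<close>
      steps back, so the Gamma arguments met are \<open>v - b - c\<close> plus natural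
      numbers.\<close>
    hence "dixon_prod (a - 2 * of_nat j) (u - of_nat j) (v - of_nat j) (b - of_nat j) (c - of_nat j) =
        (-4) ^ j * pochhammer (u - of_nat j) j * pochhammer (1 - (v - of_nat j) + (b - of_nat j) + (c - of_nat j)) j *
        dixon_prod a u v b c"
      using dixon_prod_shift[of j "v - of_nat j" "b - of_nat j" "c - of_nat j" "a - 2 * of_nat j" "u - of_nat j"] by simp
    also have "1 - (v - of_nat j) + (b - of_nat j) + (c - of_nat j) = x - of_nat j" by (simp add: x_def)
    finally have D: "dixon_prod (a - 2 * of_nat j) (u - of_nat j) (v - of_nat j) (b - of_nat j) (c - of_nat j) =
        (-4) ^ j * pochhammer (u - of_nat j) j * pochhammer (x - of_nat j) j * dixon_prod a u v b c" .
    have b: "pochhammer (b - of_nat m) k \<noteq> 0" "pochhammer (b - of_nat j) j \<noteq> 0"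
      and c: "pochhammer (c - of_nat m) k \<noteq> 0" "pochhammer (c - of_nat j) j \<noteq> 0"
      using bc s[of b] s[of c] by auto
    have sgn: "(-1 :: complex) ^ n * (-1) ^ n = 1" for n by (simp flip: power_mult_distrib)
    \<comment> \<open>Of the prefactor \<open>4 ^ m\<close>, a part \<open>4 ^ k\<close> is consumed
      by the coefficient formula and \<open>4 ^ j\<close> by the Dixon shift.\<close>
    have e: "(2 :: complex) ^ (2 * m) * (-1/4) ^ k = (-1) ^ m * (-4) ^ j"
    proof -
      have "(2 :: complex) ^ (2 * m) = 4 ^ k * 4 ^ j" by (simp add: m power_mult power_add)
      moreover have "(4 :: complex) ^ k * (-1/4) ^ k = (-1) ^ k" by (simp flip: power_mult_distrib)
      moreover have "(-4 :: complex) ^ j = (-1) ^ j * 4 ^ j" by (simp flip: power_mult_distrib)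
      ultimately show ?thesis using sgn[of j] by (simp add: m power_add)
    qed
    have alg: "p * (e * (um * uj) * (e * (xm * xj)) / (e * (bm * bj) * (e * (cm * cj)))) *
        (q * l * (g * f) * bm * cm / (g * um * xm * f)) * D = (p * q) * l * (uj * xj) / (bj * cj) * D"
      if "e \<noteq> 0" "g \<noteq> 0" "um \<noteq> 0" "xm \<noteq> 0" "bm \<noteq> 0" "cm \<noteq> 0" "f \<noteq> 0"
      for p e um uj xm xj bm bj cm cj q l g f D :: complex
      using that by (cases "bj = 0"; cases "cj = 0") (simp_all add: field_simps)
    have "2 ^ (2 * m) * ((pochhammer (1 - u) m * pochhammer (v - b - c) m) /
      (pochhammer (1 - b) m * pochhammer (1 - c) m)) *
      (pochhammer \<alpha> k * pochhammer \<beta> k * pochhammer (b - of_nat m) k * pochhammer (c - of_nat m) k /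
      (pochhammer \<gamma> k * pochhammer (u - of_nat m) k * pochhammer w k * fact k)) * dixon_prod a u v b c =
      (2 ^ (2 * m) * (-1/4) ^ k) * of_nat (L k) * (pochhammer (u - of_nat j) j * pochhammer (x - of_nat j) j) /
       (pochhammer (b - of_nat j) j * pochhammer (c - of_nat j) j) * dixon_prod a u v b c"
      unfolding L[OF k(1)] X s w x_def[symmetric] by (rule alg[OF _ nz b(1) c(1)]) simp_all
    also have "\<dots> = (-1) ^ m * (of_nat (L k) * dixon_down a u v b c j)"
      unfolding e dixon_down_def D pochhammer_reflect[of _ j] using sgn[of j] by (simp add: field_simps)
    finally show "(-1) ^ m * (of_nat (L k) * dixon_down a u v b c (m - k)) =
      2 ^ (2 * m) * ((pochhammer (1 - u) m * pochhammer (v - b - c) m) /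
      (pochhammer (1 - b) m * pochhammer (1 - c) m)) *
      (pochhammer \<alpha> k * pochhammer \<beta> k * pochhammer (b - of_nat m) k * pochhammer (c - of_nat m) k /
      (pochhammer \<gamma> k * pochhammer (u - of_nat m) k * pochhammer w k * fact k)) * dixon_prod a u v b c"
      unfolding j_def by simp
  qed
  also have "\<dots> = 2 ^ (2 * m) * ((pochhammer (1 - u) m * pochhammer (v - b - c) m) /
      (pochhammer (1 - b) m * pochhammer (1 - c) m)) *
    hyp4F3_upto K \<alpha> \<beta> (b - of_nat m) (c - of_nat m) \<gamma> (u - of_nat m) w * dixon_prod a u v b c"
    by (simp add: hyp4F3_upto_def sum_distrib_left sum_distrib_right mult_ac)
  finally show ?thesis .
qed

section \<open>Assembling the formula for both signs of the index\<close>

text \<open>The denominators at the last summed index already exclude every pole that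
  \<open>hyp_reg_up\<close> has to avoid.\<close>

lemma hyp_reg_Ptilde_Qtilde_nonneg:
  assumes s: "Re (a - 2 * b - 2 * c - of_nat n) > 0"
    and x: "(a + 1) / 2 - b - c \<notin> \<int>\<^sub>\<le>\<^sub>0" and y: "a / 2 - b - c \<notin> \<int>\<^sub>\<le>\<^sub>0"
    and okP: "hyp4F3_upto_ok ((n + 1) div 2) (- of_nat n) (a / 2) ((1 - a) / 2 + b + c)"
    and okQ: "hyp4F3_upto_ok (n div 2) (- of_nat n) ((1 + a) / 2) (1 - a / 2 + b + c)"
  shows "2 * hyp_reg (a + of_nat n) b c (a - b) (a - c) =
    Ptilde_nonneg a b c n * dixon_prod a (a / 2) ((a + 1) / 2) b c +
    Qtilde_nonneg a b c n * dixon_prod a ((a + 1) / 2) (a / 2) b c"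
proof -
  have w: "(1 - a) / 2 + b + c = 1 - (a + 1) / 2 + b + c" and u: "(1 + a) / 2 = (a + 1) / 2"
    by (simp_all add: field_simps)
  have "2 * hyp_reg (a + of_nat (Suc n) - 1) b c (a - b) (a - c) =
    (\<Sum>k\<le>Suc n. of_nat (lucas_coeff 2 (Suc n) k) * dixon_up a (a / 2) ((a + 1) / 2) b c k) +
    (\<Sum>k\<le>Suc n. of_nat (lucas_coeff 0 (Suc n) k) * dixon_up a ((a + 1) / 2) (a / 2) b c k)"
  proof (rule hyp_reg_up)
    fix k assume "2 * k \<le> Suc n"
    hence k: "k \<le> (n + 1) div 2" by simp
    have e: "1 - ((a + 1) / 2 - b - c) = (1 - a) / 2 + b + c" by (simp add: field_simps)
    have "pochhammer ((1 - a) / 2 + b + c) ((n + 1) div 2) \<noteq> 0"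
      using okP by (auto simp: hyp4F3_upto_ok_def)
    thus "(a + 1) / 2 - b - c - of_nat k \<notin> \<int>\<^sub>\<le>\<^sub>0"
      by (rule not_nonpos_Ints_diff_of_nat[OF x, unfolded e, OF _ k])
  next
    fix k assume "2 * k < Suc n"
    hence k: "k \<le> n div 2" by simp
    have e: "1 - (a / 2 - b - c) = 1 - a / 2 + b + c" by simp
    have "pochhammer (1 - a / 2 + b + c) (n div 2) \<noteq> 0"
      using okQ by (auto simp: hyp4F3_upto_ok_def)
    thus "a / 2 - b - c - of_nat k \<notin> \<int>\<^sub>\<le>\<^sub>0"
      by (rule not_nonpos_Ints_diff_of_nat[OF y, unfolded e, OF _ k])
  qed (use s in simp)
  also have "(\<Sum>k\<le>Suc n. of_nat (lucas_coeff 2 (Suc n) k) * dixon_up a (a / 2) ((a + 1) / 2) b c k) =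
      Ptilde_nonneg a b c n * dixon_prod a (a / 2) ((a + 1) / 2) b c"
    unfolding Ptilde_nonneg_def
    by (intro sum_dixon_up lucas_coeff_2_pochhammer x w okP) (auto simp: lucas_coeff_eq_0)
  also have "(\<Sum>k\<le>Suc n. of_nat (lucas_coeff 0 (Suc n) k) * dixon_up a ((a + 1) / 2) (a / 2) b c k) =
      Qtilde_nonneg a b c n * dixon_prod a ((a + 1) / 2) (a / 2) b c"
    unfolding Qtilde_nonneg_def u
    by (intro sum_dixon_up lucas_coeff_0_pochhammer y okQ[unfolded u] refl) (auto simp: lucas_coeff_0_eq_0)
  finally show ?thesis by simp
qed

text \<open>\<open>m\<close> is \<open>Suc n\<close> because the coefficient lemmas at
  \<open>n\<close> describe row \<open>n + 1\<close>; the lower parameter \<open>1 - m\<close> is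
  then \<open>-n\<close>.\<close>

lemma hyp_reg_Ptilde_Qtilde_neg:
  fixes n :: nat
  defines "m \<equiv> Suc n"
  assumes s: "Re (a - 2 * b - 2 * c + of_nat m) > -1"
    and x: "(a + 1) / 2 - b - c \<notin> \<int>\<^sub>\<le>\<^sub>0" and y: "a / 2 - b - c \<notin> \<int>\<^sub>\<le>\<^sub>0"
    and bc: "pochhammer (1 - b) m * pochhammer (1 - c) m \<noteq> 0"
    and okP: "hyp4F3_upto_ok (m div 2) (1 - of_nat m) (a / 2 - of_nat m) ((1 - a) / 2 + b + c - of_nat m)"
    and okQ: "hyp4F3_upto_ok ((m - 1) div 2) (1 - of_nat m) ((1 + a) / 2 - of_nat m) (1 - a / 2 + b + c - of_nat m)"
  shows "2 * hyp_reg (a - of_nat m - 1) b c (a - b) (a - c) =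
    Ptilde_neg a b c m * dixon_prod a (a / 2) ((a + 1) / 2) b c +
    Qtilde_neg a b c m * dixon_prod a ((a + 1) / 2) (a / 2) b c"
proof -
  have w: "(1 - a) / 2 + b + c - of_nat m = 1 - (a + 1) / 2 + b + c - of_nat m"
    and u: "(1 + a) / 2 = (a + 1) / 2" "(1 - a) / 2 = 1 - (a + 1) / 2"
    by (simp_all add: field_simps)
  have p: "- of_nat n / 2 = - (of_nat m - 1) / (2 :: complex)" "- (of_nat n + 1) / 2 = - of_nat m / (2 :: complex)"
    "- (of_nat n - 1) / 2 = - (of_nat m - 2) / (2 :: complex)" "- of_nat n = 1 - (of_nat m :: complex)"
    by (simp_all add: m_def)
  have LP: "pochhammer (- of_nat m / 2) k * pochhammer (- (of_nat m - 1) / 2) k =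
    (-1/4) ^ k * of_nat (lucas_coeff 2 m k) * (pochhammer (1 - of_nat m) k * (fact k :: complex))"
    if "k \<le> m div 2" for k
    using lucas_coeff_2_pochhammer[of k n] that unfolding p m_def[symmetric] by (simp add: m_def mult.commute)
  have LQ: "pochhammer (- (of_nat m - 1) / 2) k * pochhammer (- (of_nat m - 2) / 2) k =
    (-1/4) ^ k * of_nat (lucas_coeff 0 m k) * (pochhammer (1 - of_nat m) k * (fact k :: complex))"
    if "k \<le> (m - 1) div 2" for k
    using lucas_coeff_0_pochhammer[of k n] that unfolding p m_def[symmetric] by (simp add: m_def mult.commute)
  have P: "(-1) ^ m * (\<Sum>k\<le>m. of_nat (lucas_coeff 2 m k) * dixon_down a (a / 2) ((a + 1) / 2) b c (m - k)) =
      Ptilde_neg a b c m * dixon_prod a (a / 2) ((a + 1) / 2) b c"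
    unfolding Ptilde_neg_def u(1)
    by (intro sum_dixon_down LP x w okP bc) (auto simp: lucas_coeff_eq_0)
  have Q: "- ((-1) ^ m * (\<Sum>k\<le>m. of_nat (lucas_coeff 0 m k) * dixon_down a ((a + 1) / 2) (a / 2) b c (m - k))) =
      Qtilde_neg a b c m * dixon_prod a ((a + 1) / 2) (a / 2) b c"
    unfolding Qtilde_neg_def u mult_minus_left neg_equal_iff_equal
    by (intro sum_dixon_down LQ y okQ[unfolded u] bc refl) (auto simp: lucas_coeff_0_eq_0)
  have "2 * hyp_reg (a - of_nat m - 1) b c (a - b) (a - c) = (-1) ^ m *
    ((\<Sum>k\<le>m. of_nat (lucas_coeff 2 m k) * dixon_down a (a / 2) ((a + 1) / 2) b c (m - k)) -
    (\<Sum>k\<le>m. of_nat (lucas_coeff 0 m k) * dixon_down a ((a + 1) / 2) (a / 2) b c (m - k)))"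
    using bc by (intro hyp_reg_down s x y) auto
  thus ?thesis unfolding P[symmetric] Q[symmetric] by (simp only: right_diff_distrib) simp
qed

theorem mainTheorem4:
  fixes n :: int and a b c :: complex
  assumes "Re (a - 2 * b - 2 * c - of_int n) > 0"
    and "a - b \<notin> \<int>\<^sub>\<le>\<^sub>0"
    and "a - c \<notin> \<int>\<^sub>\<le>\<^sub>0"
    and "a \<notin> \<int>\<^sub>\<le>\<^sub>0"
    and "(a + 1) / 2 - b - c \<notin> \<int>\<^sub>\<le>\<^sub>0"
    and "a / 2 - b - c \<notin> \<int>\<^sub>\<le>\<^sub>0"
    and "Ptilde_ok a b c n"
    and "Qtilde_ok a b c n"
  shows "hyp3F2 (a + of_int n) b c (a - b) (a - c) =
      Ptilde a b c n / 2 *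
        (Gamma ((a + 1) / 2) * Gamma (a - b) * Gamma (a - c) * Gamma ((a + 1) / 2 - b - c) *
         (rGamma a * rGamma ((a + 1) / 2 - b) * rGamma ((a + 1) / 2 - c) * rGamma (a - b - c)))
    + Qtilde a b c n / 2 *
        (Gamma (a / 2) * Gamma (a - b) * Gamma (a - c) * Gamma (a / 2 - b - c) *
         (rGamma a * rGamma (a / 2 - b) * rGamma (a / 2 - c) * rGamma (a - b - c)))"
proof -
  note s = assms(1) and x = assms(5) and y = assms(6)
  let ?G1 = "dixon_prod a (a / 2) ((a + 1) / 2) b c" and ?G2 = "dixon_prod a ((a + 1) / 2) (a / 2) b c"
  \<comment> \<open>The third case begins at \<open>n = -2\<close>, that is, at
    \<open>m = Suc k\<close> with \<open>k = 0\<close>.\<close>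
  consider "n = -1" | k where "n = int k" | k where "n = - int (Suc k) - 1"
  proof -
    have "n = -1 \<or> n = int (nat n) \<or> n = - int (Suc (nat (- n - 2))) - 1" by linarith
    thus ?thesis using that by blast
  qed
  hence main: "2 * hyp_reg (a + of_int n) b c (a - b) (a - c) = Ptilde a b c n * ?G1 + Qtilde a b c n * ?G2"
  proof cases
    case 1
    thus ?thesis using dixon_reg[of a b c] s x by (simp add: Ptilde_def Qtilde_def)
  next
    case (2 k)
    thus ?thesis
      using hyp_reg_Ptilde_Qtilde_nonneg[of a b c k] s x y assms(7,8)
      by (simp add: Ptilde_def Qtilde_def Ptilde_ok_def Qtilde_ok_def)
  next
    case (3 k)
    hence n: "n \<noteq> -1" "\<not> 0 \<le> n" "nat (- n - 1) = Suc k" "a + of_int n = a - of_nat (Suc k) - 1"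
      by simp_all
    show ?thesis
      unfolding Ptilde_def Qtilde_def n if_False n(1)[THEN if_not_P] n(2)[THEN if_not_P]
      using assms(7,8) s 3 n
      by (intro hyp_reg_Ptilde_Qtilde_neg x y) (simp_all add: Ptilde_ok_def Qtilde_ok_def Let_def)
  qed
  have "hyp3F2 (a + of_int n) b c (a - b) (a - c) =
      Gamma (a - b) * Gamma (a - c) * (2 * hyp_reg (a + of_int n) b c (a - b) (a - c)) / 2"
    using hyp3F2_eq_hyp_reg[OF assms(2,3)] s by simp
  also have "\<dots> = Ptilde a b c n / 2 * (Gamma (a - b) * Gamma (a - c) * ?G1) +
      Qtilde a b c n / 2 * (Gamma (a - b) * Gamma (a - c) * ?G2)"
    unfolding main by (simp add: field_simps)
  \<comment> \<open>Legendre's formula is read backwards here, which is legitimate since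
    \<open>a\<close> is not a pole of Gamma.\<close>
  finally show ?thesis
    unfolding dixon_prod_def Gamma_half_quotient[OF assms(4), symmetric] by (simp only: mult_ac)
qed

end
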